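(* The monoid $\Pi$ is presented, as a monoid, by the generators $v_i,h_i,\sigma_i$ ($i\in\mathbb N$) and the following relations, in which $x,y$ range over $\{h,v\}$ (each independently) and all subscripts are in $\mathbb N$: (R1) $x_jy_i=y_ix_{j+1}$ for $i<j$; (R2) $\sigma_i^2=1$ for $i\ge 0$; (R3) $\sigma_i\sigma_j=\sigma_j\sigma_i$ for $|i-j|\ge 2$; (R4) $\sigma_i\sigma_{i+1}\sigma_i=\sigma_{i+1}\sigma_i\sigma_{i+1}$ for $i\ge 0$; (R5) for $i\ge0$, $j\ge 0$: $\sigma_jx_i=x_i\sigma_{j+1}$ if $i<j$; $\sigma_jx_i=x_{j+1}\sigma_j\sigma_{j+1}$ if $i=j$; $\sigma_jx_i=x_j\sigma_{j+1}\sigma_j$ if $i=j+1$; $\sigma_jx_i=x_i\sigma_j$ if $i>j+1$; (R6) $v_ih_{i+1}h_i=h_iv_{i+1}v_i\sigma_{i+1}$ for $i\ge0$.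
   Context: $\mathbb N=\{0,1,2,\dots\}$. For $i\in\mathbb N$ let $S_i=[2i,2i+1]\times[0,1]$ and $X=\bigcup_i S_i$. The trivial pattern in $X$ is the set of rectangles $\{S_i\mid i\in\mathbb N\}$. A simple increment of a pattern replaces one rectangle $R$ of the pattern by the two congruent rectangles obtained by dividing $R$ exactly in half by a vertical line (vertical division) or a horizontal line (horizontal division), leaving the other rectangles alone. A pattern is a set of rectangles obtainable from the trivial pattern by finitely many simple increments. A numbered pattern is a bijection $i\mapsto R_i$ from $\mathbb N$ to the rectangles of a pattern for which there are $j,k\in\mathbb N$ such that for every $i>k$ the square $S_i$ contains only one rectangle of the pattern and the number of that rectangle is $i+j$. A numbered pattern determines a continuous function $f:X\to X$: for each $i$, $f|_{S_i}$ is the restriction of the unique affine map of the form $(x,y)\mapsto(a+2^px,b+2^qy)$, $p,q\in\mathbb Z$, carrying $S_i$ onto $R_i$. The set of these functions is a monoid $\Pi$ under composition (functions act on the left, composed from right to left, so $PQ=P\circ Q$); different numbered patterns give different functions, and a numbered pattern is identified with its function. Special elements, for $i\in\mathbb N$: $v_i$ is the numbered pattern in which $S_i$ is divided vertically, with left half numbered $i$ and right half numbered $i+1$, and every $S_j$ with $j\neq i$ is a single rectangle, numbered $j$ if $j<i$ and $j+1$ if $j>i$. $h_i$ is the numbered pattern in which $S_i$ is divided horizontally, with bottom half numbered $i$ and top half numbered $i+1$, and every $S_j$ with $j\ne i$ is a single rectangle, numbered $j$ if $j<i$ and $j+1$ if $j>i$. $\sigma_i$ is the trivial pattern with $S_i$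 numbered $i+1$, $S_{i+1}$ numbered $i$, and $S_j$ numbered $j$ for $j\notin\{i,i+1\}$. *)

theory Defs
  imports Complex_Main "HOL-Algebra.Group"
begin

section \<open>Presentations of monoids\<close>

inductive word_cong :: "('g list \<times> 'g list) set \<Rightarrow> 'g list \<Rightarrow> 'g list \<Rightarrow> bool"
  for Rel :: "('g list \<times> 'g list) set" where
  rel: "(u, w) \<in> Rel \<Longrightarrow> word_cong Rel u w"
| refl: "word_cong Rel u u"
| sym: "word_cong Rel u w \<Longrightarrow> word_cong Rel w u"
| trans: "word_cong Rel u w \<Longrightarrow> word_cong Rel w t \<Longrightarrow> word_cong Rel u t"
| append: "word_cong Rel u u' \<Longrightarrow> word_cong Rel w w' \<Longrightarrow> word_cong Rel (u @ w) (u' @ w')"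

definition word_class :: "('g list \<times> 'g list) set \<Rightarrow> 'g list \<Rightarrow> 'g list set" where
  "word_class Rel w = {u. word_cong Rel w u}"

text \<open>The quotient of the free monoid on the type of generators by the congruence generated
  by \<open>Rel\<close>.  All the classes in the union defining the product coincide.\<close>

definition presented_monoid :: "('g list \<times> 'g list) set \<Rightarrow> 'g list set monoid" where
  "presented_monoid Rel =
    \<lparr>carrier = range (word_class Rel),
     mult = (\<lambda>A B. \<Union>u\<in>A. \<Union>w\<in>B. word_class Rel (u @ w)),
     one = word_class Rel []\<rparr>"

text \<open>\<open>M\<close> is presented by the generators \<open>\<phi> g\<close> and the relations \<open>Rel\<close>.  An element of
  \<^const>\<open>iso\<close> between two monoids preserves the unit automatically, being onto.\<close>

definition has_monoid_presentation ::
    "('a, 'b) monoid_scheme \<Rightarrow> ('g \<Rightarrow> 'a) \<Rightarrow> ('g list \<times> 'g list) set \<Rightarrow> bool" where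
  "has_monoid_presentation M \<phi> Rel \<longleftrightarrow>
    monoid M \<and> range \<phi> \<subseteq> carrier M \<and>
    (\<exists>F \<in> iso (presented_monoid Rel) M. \<forall>g. F (word_class Rel [g]) = \<phi> g)"

section \<open>Numbered patterns and the monoid they form\<close>

definition Sq :: "nat \<Rightarrow> (real \<times> real) set" where
  "Sq i = {2 * real i .. 2 * real i + 1} \<times> {0..1}"

definition XX :: "(real \<times> real) set" where
  "XX = (\<Union>i. Sq i)"

inductive simple_increment :: "(real \<times> real) set set \<Rightarrow> (real \<times> real) set set \<Rightarrow> bool" where
  vertical: "{a..b} \<times> {c..d} \<in> P \<Longrightarrow> a < b \<Longrightarrow> c < d \<Longrightarrow>
    simple_increment P
      (P - {{a..b} \<times> {c..d}} \<union> {{a..(a + b) / 2} \<times> {c..d}, {(a + b) / 2..b} \<times> {c..d}})"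
| horizontal: "{a..b} \<times> {c..d} \<in> P \<Longrightarrow> a < b \<Longrightarrow> c < d \<Longrightarrow>
    simple_increment P
      (P - {{a..b} \<times> {c..d}} \<union> {{a..b} \<times> {c..(c + d) / 2}, {a..b} \<times> {(c + d) / 2..d}})"

definition is_pattern :: "(real \<times> real) set set \<Rightarrow> bool" where
  "is_pattern P \<longleftrightarrow> simple_increment\<^sup>*\<^sup>* (range Sq) P"

definition numbered_pattern :: "(nat \<Rightarrow> (real \<times> real) set) \<Rightarrow> bool" where
  "numbered_pattern R \<longleftrightarrow>
    (\<exists>P. is_pattern P \<and> bij_betw R UNIV P \<and>
      (\<exists>j k. \<forall>i>k. {Q \<in> P. Q \<subseteq> Sq i} = {R (i + j)}))"

definition dyadic_affine :: "(real \<times> real \<Rightarrow> real \<times> real) \<Rightarrow> bool" where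
  "dyadic_affine g \<longleftrightarrow>
    (\<exists>a b. \<exists>p q :: int. g = (\<lambda>(x, y). (a + 2 powi p * x, b + 2 powi q * y)))"

definition affine_fit ::
    "(real \<times> real) set \<Rightarrow> (real \<times> real) set \<Rightarrow> real \<times> real \<Rightarrow> real \<times> real" where
  "affine_fit A B = (THE g. dyadic_affine g \<and> g ` A = B)"

definition pattern_fun :: "(nat \<Rightarrow> (real \<times> real) set) \<Rightarrow> real \<times> real \<Rightarrow> real \<times> real" where
  "pattern_fun R = (\<lambda>z\<in>XX. let i = (THE i. z \<in> Sq i) in affine_fit (Sq i) (R i) z)"

text \<open>Self-maps of \<open>XX\<close> are represented by functions that are \<^const>\<open>undefined\<close> outside \<open>XX\<close>,
  so that equality of elements is equality of maps on \<open>XX\<close>.\<close>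

definition Pi_monoid :: "(real \<times> real \<Rightarrow> real \<times> real) monoid" where
  "Pi_monoid =
    \<lparr>carrier = {pattern_fun R | R. numbered_pattern R}, mult = compose XX, one = (\<lambda>z\<in>XX. z)\<rparr>"

section \<open>Generators and relations\<close>

definition v_pat :: "nat \<Rightarrow> nat \<Rightarrow> (real \<times> real) set" where
  "v_pat i n =
    (if n < i then Sq n
     else if n = i then {2 * real i .. 2 * real i + 1/2} \<times> {0..1}
     else if n = i + 1 then {2 * real i + 1/2 .. 2 * real i + 1} \<times> {0..1}
     else Sq (n - 1))"

definition h_pat :: "nat \<Rightarrow> nat \<Rightarrow> (real \<times> real) set" where
  "h_pat i n =
    (if n < i then Sq n
     else if n = i then {2 * real i .. 2 * real i + 1} \<times> {0..1/2}
     else if n = i + 1 then {2 * real i .. 2 * real i + 1} \<times> {1/2..1}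
     else Sq (n - 1))"

definition sigma_pat :: "nat \<Rightarrow> nat \<Rightarrow> (real \<times> real) set" where
  "sigma_pat i n = Sq (if n = i then i + 1 else if n = i + 1 then i else n)"

datatype dir = Hor | Ver

datatype gen = Div dir nat | Swap nat

fun gen_val :: "gen \<Rightarrow> real \<times> real \<Rightarrow> real \<times> real" where
  "gen_val (Div Ver i) = pattern_fun (v_pat i)"
| "gen_val (Div Hor i) = pattern_fun (h_pat i)"
| "gen_val (Swap i) = pattern_fun (sigma_pat i)"

inductive_set Pi_relations :: "(gen list \<times> gen list) set" where
  R1: "i < j \<Longrightarrow> ([Div x j, Div y i], [Div y i, Div x (j + 1)]) \<in> Pi_relations"
| R2: "([Swap i, Swap i], []) \<in> Pi_relations"
| R3: "i + 2 \<le> j \<or> j + 2 \<le> i \<Longrightarrow> ([Swap i, Swap j], [Swap j, Swap i]) \<in> Pi_relations"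
| R4: "([Swap i, Swap (i + 1), Swap i], [Swap (i + 1), Swap i, Swap (i + 1)]) \<in> Pi_relations"
| R5a: "i < j \<Longrightarrow> ([Swap j, Div x i], [Div x i, Swap (j + 1)]) \<in> Pi_relations"
| R5b: "i = j \<Longrightarrow> ([Swap j, Div x i], [Div x (j + 1), Swap j, Swap (j + 1)]) \<in> Pi_relations"
| R5c: "i = j + 1 \<Longrightarrow> ([Swap j, Div x i], [Div x j, Swap (j + 1), Swap j]) \<in> Pi_relations"
| R5d: "i > j + 1 \<Longrightarrow> ([Swap j, Div x i], [Div x i, Swap j]) \<in> Pi_relations"
| R6: "([Div Ver i, Div Hor (i + 1), Div Hor i],
        [Div Hor i, Div Ver (i + 1), Div Ver i, Swap (i + 1)]) \<in> Pi_relations"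

end

theory Submission
  imports Defs "HOL-Combinatorics.Permutations"
begin

text \<open>
  The product \<open>P \<circ> Q\<close> of two numbered patterns inserts a copy of what \<open>Q\<close> does in \<open>S\<^sub>m\<close> into the
  rectangle that \<open>P\<close> numbers \<open>m\<close>. A word in the generators is therefore a recipe, read from left
  to right: a letter \<open>v\<^sub>i\<close> or \<open>h\<^sub>i\<close> halves the rectangle that currently has number \<open>i\<close>, and
  \<open>\<sigma>\<^sub>i\<close> exchanges the numbers \<open>i\<close> and \<open>i + 1\<close>. The theorem then consists of three facts.

  The relations hold: both sides are recipes for the same numbered pattern
  (\<open>word_numbering_relation\<close>).

  The generators generate: a pattern arises by finitely many halvings, and two numberings of one
  pattern that are both shifts far out differ by a permutation of \<open>\<nat>\<close>. Counting shows that the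
  two shifts agree, so that the permutation moves only finitely many numbers and is a product of
  adjacent transpositions (\<open>numbered_pattern_word\<close>).

  The relations suffice (\<open>numbering_inject\<close>). The relations \<open>R5a\<close> to \<open>R5d\<close> move all
  transpositions to the right end of a word. By \<open>R1\<close>, the remaining product of halvings depends
  only on a forest of binary trees, one tree for each square, with inner nodes labelled by the
  direction of division; the leaves of the forest are the rectangles of the pattern, numbered
  from left to right (\<open>forest_normal_form\<close>). A pattern can come from several forests, and this
  is where \<open>R6\<close> enters. If no rectangle of a pattern in one square crosses the middle line of
  direction \<open>x\<close>, then every tree for this pattern can be rewritten to have a root of direction
  \<open>x\<close>: if its root has the other direction, do so for its two subtrees and exchange the two
  levels by \<open>R6\<close> (\<open>divisible_tree\<close>). Hence two trees with the same leaves can be given the same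
  root, and their subtrees are handled by induction (\<open>tree_equiv_if_leaves_eq\<close>). All this
  changes the numbering of the leaves, and so it is only valid up to a product of transpositions
  on the right. The last step is that \<open>R2\<close> to \<open>R4\<close> present the group of permutations of \<open>\<nat>\<close> with
  finite support (\<open>sprod_eq\<close>).

  Real numbers are kept out of this argument: a rectangle is encoded by its address, that is,
  the square it lies in and the sequences of left/right and of bottom/top choices that lead to
  it. Composition of maps becomes concatenation of addresses (\<open>realize_star\<close>).
\<close>

section \<open>Addresses\<close>

text \<open>
  In \<open>(m, u, v)\<close>, the list \<open>u\<close> records the vertical divisions of \<open>S\<^sub>m\<close> that lead to a rectangle
  (\<^const>\<open>True\<close> for the right half) and \<open>v\<close> the horizontal ones (\<^const>\<open>True\<close> for the top half). How the
  two kinds of division are interleaved does not influence the rectangle, and this is what makes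
  \<open>R6\<close> true.
\<close>

type_synonym address = "nat \<times> bool list \<times> bool list"

fun refine :: "address \<Rightarrow> address \<Rightarrow> address" where
  "refine (m, u, v) (_, u', v') = (m, u @ u', v @ v')"

text \<open>
  The composition of maps, on the level of addresses: \<open>E\<close> sends \<open>S\<^sub>n\<close> into \<open>S\<^sub>m\<close> with
  \<open>m = fst (E n)\<close>, and \<open>C\<close> carries \<open>S\<^sub>m\<close> onto the rectangle with address \<open>C m\<close>.
\<close>

definition star :: "(nat \<Rightarrow> address) \<Rightarrow> (nat \<Rightarrow> address) \<Rightarrow> nat \<Rightarrow> address"  (infixl "\<star>" 70) where
  "(C \<star> E) n = refine (C (fst (E n))) (E n)"

definition triv :: "nat \<Rightarrow> address" where
  "triv n = (n, [], [])"

fun half :: "dir \<Rightarrow> bool \<Rightarrow> address \<Rightarrow> address" where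
  "half Ver b (m, u, v) = (m, u @ [b], v)"
| "half Hor b (m, u, v) = (m, u, v @ [b])"

fun gen_numbering :: "gen \<Rightarrow> nat \<Rightarrow> address" where
  "gen_numbering (Div x i) n =
    (if n < i then triv n else if n = i then half x False (triv i)
     else if n = Suc i then half x True (triv i) else triv (n - 1))"
| "gen_numbering (Swap i) n = triv (transpose i (Suc i) n)"

definition word_numbering :: "gen list \<Rightarrow> nat \<Rightarrow> address" where
  "word_numbering w = foldr (\<lambda>g C. gen_numbering g \<star> C) w triv"

lemma refine_triv [simp]: "refine c (triv n) = c" "refine (triv (fst c)) c = c"
  by (cases c; simp add: triv_def)+

lemma fst_refine [simp]: "fst (refine c d) = fst c"
  by (cases c; cases d) simp

lemma fst_triv [simp]: "fst (triv n) = n"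
  by (simp add: triv_def)

lemma fst_half [simp]: "fst (half x b c) = fst c"
  by (cases c; cases x) simp_all

lemma refine_half: "refine c (half x b d) = half x b (refine c d)"
  by (cases c; cases x; cases d) simp_all

lemma refine_assoc: "refine (refine c d) e = refine c (refine d e)"
  by (cases c; cases d; cases e) simp

lemma star_triv [simp]: "C \<star> triv = C" "triv \<star> C = C"
  by (simp_all add: star_def fun_eq_iff)

lemma star_assoc: "C \<star> E \<star> F = C \<star> (E \<star> F)"
  by (simp add: star_def fun_eq_iff refine_assoc)

lemma word_numbering_Nil [simp]: "word_numbering [] = triv"
  by (simp add: word_numbering_def)

lemma word_numbering_Cons: "word_numbering (g # w) = gen_numbering g \<star> word_numbering w"
  by (simp add: word_numbering_def)

lemma word_numbering_append: "word_numbering (u @ w) = word_numbering u \<star> word_numbering w"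
  by (induction u) (simp_all add: word_numbering_Cons star_assoc)

lemma half_commute: "half Ver b (half Hor b' c) = half Hor b' (half Ver b c)"
  by (cases c) simp

lemma word_numbering_relation: "(u, w) \<in> Pi_relations \<Longrightarrow> word_numbering u = word_numbering w"
proof (induction rule: Pi_relations.induct)
  case (R6 i)
  show ?case
  proof
    fix n
    \<comment> \<open>The letters treat the numbers \<open>i, \<dots>, i + 3\<close> specially; all others are only shifted.\<close>
    consider "n < i" | "n = i" | "n = Suc i" | "n = Suc (Suc i)" | "n = Suc (Suc (Suc i))"
      | k where "n = Suc (Suc (Suc (Suc (i + k))))"
    proof -
      have "n < i \<or> n = i \<or> n = Suc i \<or> n = Suc (Suc i) \<or> n = Suc (Suc (Suc i))
          \<or> n = Suc (Suc (Suc (Suc (i + (n - i - 4)))))" by linarith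
      with that show thesis by blast
    qed
    then show "word_numbering [Div Ver i, Div Hor (i + 1), Div Hor i] n
        = word_numbering [Div Hor i, Div Ver (i + 1), Div Ver i, Swap (i + 1)] n"
      by cases (simp_all add: word_numbering_Cons star_def refine_half half_commute transpose_def)
  qed
qed (auto simp: fun_eq_iff word_numbering_Cons star_def refine_half transpose_def)

lemma word_numbering_cong: "word_cong Pi_relations u w \<Longrightarrow> word_numbering u = word_numbering w"
  by (induction rule: word_cong.induct) (simp_all add: word_numbering_relation
      word_numbering_append)

section \<open>The monoid defined by the relations\<close>

lemma equivp_word_cong: "equivp (word_cong Rel)"
  by (intro equivpI reflpI sympI transpI)
     (blast intro: word_cong.refl word_cong.sym word_cong.trans)+

text \<open>
  The presented monoid as a type, so that the consequences of the relations can be derived by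
  equational reasoning in the class \<^class>\<open>monoid_mult\<close>.
\<close>

quotient_type word_monoid = "gen list" / "word_cong Pi_relations"
  by (rule equivp_word_cong)

instantiation word_monoid :: monoid_mult
begin

lift_definition one_word_monoid :: word_monoid is "[]" .

lift_definition times_word_monoid :: "word_monoid \<Rightarrow> word_monoid \<Rightarrow> word_monoid" is "(@)"
  by (rule word_cong.append)

instance
  by standard (transfer; simp add: word_cong.refl)+

end

lift_definition cls :: "gen list \<Rightarrow> word_monoid" is "\<lambda>w. w" .

lemma cls_eq_iff: "cls u = cls w \<longleftrightarrow> word_cong Pi_relations u w"
  by transfer simp

lemma cls_Nil [simp]: "cls [] = 1"
  by transfer (rule word_cong.refl)

lemma cls_append: "cls (u @ w) = cls u * cls w"
  by transfer (rule word_cong.refl)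

lemma cls_Cons: "cls (g # w) = cls [g] * cls w"
  using cls_append[of "[g]" w] by simp

definition D :: "dir \<Rightarrow> nat \<Rightarrow> word_monoid" where
  "D x i = cls [Div x i]"

definition S :: "nat \<Rightarrow> word_monoid" where
  "S j = cls [Swap j]"

lemma cls_relation: "(u, w) \<in> Pi_relations \<Longrightarrow> cls u = cls w"
  by (simp add: cls_eq_iff word_cong.rel)

lemma D_D: "i < j \<Longrightarrow> D x j * D y i = D y i * D x (Suc j)"
  using cls_relation[OF Pi_relations.R1[of i j x y]]
  by (simp add: D_def cls_Cons[of _ "_ # _"])

lemma S_S: "S i * S i = 1"
  using cls_relation[OF Pi_relations.R2[of i]]
  by (simp add: S_def cls_Cons[of _ "_ # _"])

lemma S_commute: "i + 2 \<le> j \<or> j + 2 \<le> i \<Longrightarrow> S i * S j = S j * S i"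
  using cls_relation[OF Pi_relations.R3[of i j]]
  by (simp add: S_def cls_Cons[of _ "_ # _"])

lemma S_braid: "S i * (S (Suc i) * S i) = S (Suc i) * (S i * S (Suc i))"
  using cls_relation[OF Pi_relations.R4[of i]]
  by (simp add: S_def cls_Cons[of _ "_ # _"])

lemma S_D_above: "i < j \<Longrightarrow> S j * D x i = D x i * S (Suc j)"
  using cls_relation[OF Pi_relations.R5a[of i j x]]
  by (simp add: S_def D_def cls_Cons[of _ "_ # _"])

lemma S_D_first: "S j * D x j = D x (Suc j) * (S j * S (Suc j))"
  using cls_relation[OF Pi_relations.R5b[of j j x]]
  by (simp add: S_def D_def cls_Cons[of _ "_ # _"])

lemma S_D_second: "S j * D x (Suc j) = D x j * (S (Suc j) * S j)"
  using cls_relation[OF Pi_relations.R5c[of "Suc j" j x]]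
  by (simp add: S_def D_def cls_Cons[of _ "_ # _"])

lemma S_D_below: "Suc j < i \<Longrightarrow> S j * D x i = D x i * S j"
  using cls_relation[OF Pi_relations.R5d[of j i x]]
  by (simp add: S_def D_def cls_Cons[of _ "_ # _"])

lemma D_cross: "D Ver i * (D Hor (Suc i) * D Hor i)
    = D Hor i * (D Ver (Suc i) * (D Ver i * S (Suc i)))"
  using cls_relation[OF Pi_relations.R6[of i]]
  by (simp add: S_def D_def cls_Cons[of _ "_ # _"])

section \<open>Products of adjacent transpositions\<close>

definition sprod :: "nat list \<Rightarrow> word_monoid" where
  "sprod s = cls (map Swap s)"

lemma sprod_Nil [simp]: "sprod [] = 1"
  by (simp add: sprod_def)

lemma sprod_append: "sprod (s @ t) = sprod s * sprod t"
  by (simp add: sprod_def cls_append)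

lemma sprod_Cons: "sprod (j # s) = S j * sprod s"
  using sprod_append[of "[j]" s] by (simp add: sprod_def S_def)

text \<open>
  Reversal inverts because the letters are involutions.
\<close>

lemma sprod_rev: "sprod s * sprod (rev s) = 1"
proof (induction s)
  case (Cons j s)
  have "sprod (j # s) * sprod (rev (j # s)) = S j * (sprod s * sprod (rev s)) * S j"
    by (simp add: sprod_append sprod_Cons mult.assoc)
  then show ?case by (simp add: Cons.IH S_S)
qed simp

lemma sprod_rev': "sprod (rev s) * sprod s = 1"
  using sprod_rev[of "rev s"] by simp

definition perm :: "nat list \<Rightarrow> nat \<Rightarrow> nat" where
  "perm s = foldr (\<lambda>j p. transpose j (Suc j) \<circ> p) s id"

lemma perm_Nil [simp]: "perm [] = id"
  by (simp add: perm_def)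

lemma perm_Cons: "perm (j # s) = transpose j (Suc j) \<circ> perm s"
  by (simp add: perm_def)

lemma perm_append: "perm (s @ t) = perm s \<circ> perm t"
  by (induction s) (simp_all add: perm_Cons comp_assoc)

lemma perm_rev: "perm s \<circ> perm (rev s) = id"
proof (induction s)
  case (Cons j s)
  have "perm (j # s) \<circ> perm (rev (j # s))
      = transpose j (Suc j) \<circ> (perm s \<circ> perm (rev s)) \<circ> transpose j (Suc j)"
    by (simp add: perm_append perm_Cons comp_assoc)
  then show ?case by (simp add: Cons.IH)
qed simp

lemma perm_rev': "perm (rev s) \<circ> perm s = id"
  using perm_rev[of "rev s"] by simp

lemma bij_perm: "bij (perm s)"
  using perm_rev perm_rev' by (rule o_bij[rotated])

lemma perm_above: "set s \<subseteq> {..<n} \<Longrightarrow> n < m \<Longrightarrow> perm s m = m"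
  by (induction s) (auto simp: perm_Cons transpose_def)

text \<open>
  The product of \<open>\<sigma>\<^bsub>n-1\<^esub>, \<dots>, \<sigma>\<^sub>k\<close> in this order is the cycle that sends \<open>k\<close> to \<open>n\<close>. These cycles
  represent the cosets of the permutations that fix \<open>n\<close> in those that fix all numbers above \<open>n\<close>.
\<close>

abbreviation descending :: "nat \<Rightarrow> nat \<Rightarrow> nat list" where
  "descending n k \<equiv> rev [k..<n]"

lemma perm_descending: "k \<le> n \<Longrightarrow> perm (descending n k) k = n"
proof (induction "n - k" arbitrary: k)
  case (Suc d)
  then have "[k..<n] = k # [Suc k..<n]" by (simp add: upt_rec)
  then show ?case using Suc by (simp add: perm_append perm_Cons)
qed simp

lemma sprod_commute:
  "(\<And>i. i \<in> set s \<Longrightarrow> i + 2 \<le> j \<or> j + 2 \<le> i) \<Longrightarrow> sprod s * S j = S j * sprod s"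
proof (induction s)
  case (Cons i s)
  have "sprod (i # s) * S j = S i * S j * sprod s"
    using Cons by (simp add: sprod_Cons mult.assoc)
  also have "S i * S j = S j * S i"
    by (rule S_commute) (use Cons.prems[of i] in simp)
  finally show ?case by (simp add: sprod_Cons mult.assoc)
qed simp

lemma word_numbering_Swap: "word_numbering (map Swap s) = triv \<circ> perm s"
  by (induction s) (auto simp: word_numbering_Cons perm_Cons star_def fun_eq_iff)

lemma perm_eq: "sprod s = sprod t \<Longrightarrow> perm s = perm t"
  by (metis (no_types, lifting) comp_apply ext fst_triv word_numbering_Swap word_numbering_cong
      sprod_def cls_eq_iff)

text \<open>
  If \<open>j = k\<close>, the last letter cancels. Otherwise \<open>\<sigma>\<^sub>j\<close> moves to the left up to the letters \<open>j\<close>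
  and \<open>j - 1\<close>, the braid relation turns it into \<open>\<sigma>\<^bsub>j-1\<^esub>\<close>, and this commutes with all letters
  further to the left.
\<close>

lemma descending_times_S:
  assumes "k \<le> j" "j < n"
  shows "\<exists>s k'. set s \<subseteq> {..<n - 1} \<and> k' \<le> n
    \<and> sprod (descending n k) * S j = sprod s * sprod (descending n k')"
proof (cases "j = k")
  case True
  then have "[k..<n] = k # [Suc k..<n]" using assms by (simp add: upt_rec)
  then have "sprod (descending n k) * S j = sprod [] * sprod (descending n (Suc k))"
    using True by (simp add: sprod_append sprod_Cons mult.assoc S_S)
  then show ?thesis using assms True by (metis Suc_leI empty_set empty_subsetI)
next
  case False
  define i where "i = j - 1"
  with False assms have j: "j = Suc i" "k \<le> i" by auto
  \<comment> \<open>The letters \<open>i + 1, i\<close> are the ones that form a braid with \<open>\<sigma>\<^sub>j\<close>.\<close>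
  have "[k..<n] = [k..<i] @ [i..<n]"
    using j assms upt_add_eq_append[of k i "n - i"] by simp
  also have "[i..<n] = i # Suc i # [Suc (Suc i)..<n]"
    using j assms by (simp add: upt_rec)
  finally have descending: "descending n k
      = descending n (Suc (Suc i)) @ [Suc i, i] @ descending i k"
    by simp
  have low: "sprod (descending i k) * S (Suc i) = S (Suc i) * sprod (descending i k)"
    by (rule sprod_commute) auto
  have high: "sprod (descending n (Suc (Suc i))) * S i = S i * sprod (descending n (Suc (Suc i)))"
    by (rule sprod_commute) auto
  have "sprod (descending n k) * S j
      = sprod (descending n (Suc (Suc i))) * (S (Suc i)
          * (S i * S (Suc i))) * sprod (descending i k)"
    by (simp add: descending j sprod_append sprod_Cons mult.assoc low)
  also have "\<dots> = sprod (descending n (Suc (Suc i))) * S i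
      * (S (Suc i) * S i * sprod (descending i k))"
    by (simp only: S_braid[symmetric] mult.assoc)
  also have "\<dots> = S i * sprod (descending n k)"
    by (simp add: high descending sprod_append sprod_Cons mult.assoc)
  finally have "sprod (descending n k) * S j = sprod [i] * sprod (descending n k)"
    by (simp add: sprod_Cons)
  moreover have "set [i] \<subseteq> {..<n - 1}" "k \<le> n" using j assms by auto
  ultimately show ?thesis by blast
qed

text \<open>
  The coset decomposition, derived from the relations alone by multiplying with one letter at a
  time.
\<close>

lemma sprod_normal_form:
  assumes "set s \<subseteq> {..<n}"
  shows "\<exists>s' k. set s' \<subseteq> {..<n - 1} \<and> k \<le> n \<and> sprod s = sprod s' * sprod (descending n k)"
  using assms
proof (induction s rule: rev_induct)
  case Nil
  have "sprod [] = sprod [] * sprod (descending n n)" by simp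
  then show ?case by (metis empty_set empty_subsetI order_refl)
next
  case (snoc j s)
  then obtain s' k where s': "set s' \<subseteq> {..<n - 1}" "k \<le> n" "sprod s
      = sprod s' * sprod (descending n k)"
    and "j < n" by auto
  have "\<exists>t k'. set t \<subseteq> {..<n - 1} \<and> k' \<le> n \<and> sprod (descending n k) * S j
      = sprod t * sprod (descending n k')"
  proof (cases "k \<le> j")
    case True
    then show ?thesis using descending_times_S \<open>j < n\<close> by blast
  next
    case False
    show ?thesis
    proof (cases "Suc j = k")
      case True
      then have "[j..<n] = j # [k..<n]" using \<open>j < n\<close> by (simp add: upt_rec)
      then have "sprod (descending n k) * S j = sprod [] * sprod (descending n j)"
        by (simp add: sprod_append sprod_Cons)
      then show ?thesis using \<open>j < n\<close> by (metis empty_set empty_subsetI less_imp_le)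
    next
      case neq: False
      have "sprod (descending n k) * S j = S j * sprod (descending n k)"
        by (rule sprod_commute) (use False neq in auto)
      then have "sprod (descending n k) * S j = sprod [j] * sprod (descending n k)"
        by (simp add: sprod_Cons)
      moreover have "set [j] \<subseteq> {..<n - 1}" using False neq s'(2) by auto
      ultimately show ?thesis using s'(2) by blast
    qed
  qed
  then obtain t k' where t: "set t \<subseteq> {..<n - 1}" "k' \<le> n"
      "sprod (descending n k) * S j = sprod t * sprod (descending n k')"
    by blast
  have "sprod (s @ [j]) = sprod (s' @ t) * sprod (descending n k')"
    using t(3) by (simp add: sprod_append sprod_Cons s'(3) mult.assoc)
  moreover have "set (s' @ t) \<subseteq> {..<n - 1}" using s' t by simp
  ultimately show ?case using t(2) by blast
qed

text \<open>
  In the normal form, the first factor fixes \<open>n\<close> and the cycle sends \<open>k\<close> to \<open>n\<close>. For the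
  identity this forces \<open>k = n\<close>, which leaves a product with a smaller bound.
\<close>

lemma sprod_trivial:
  assumes "set s \<subseteq> {..<n}" "perm s = id"
  shows "sprod s = 1"
  using assms
proof (induction n arbitrary: s)
  case (Suc n)
  obtain s' k where s': "set s' \<subseteq> {..<n}" "k \<le> Suc n" "sprod s
      = sprod s' * sprod (descending (Suc n) k)"
    using sprod_normal_form[OF Suc.prems(1)] by auto
  then have "perm s = perm (s' @ descending (Suc n) k)"
    by (intro perm_eq) (simp add: sprod_append)
  then have p: "perm s' \<circ> perm (descending (Suc n) k) = id"
    using Suc.prems(2) by (simp only: perm_append)
  then have "perm s' (Suc n) = k"
    using perm_descending[OF s'(2)] by (metis comp_apply id_apply)
  then have "k = Suc n"
    using perm_above[OF s'(1)] by simp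
  with p s'(3) have "perm s' = id" "sprod s = sprod s'" by simp_all
  then show ?case using Suc.IH[OF s'(1)] by simp
qed simp

text \<open>
  The Coxeter presentation of the group of permutations of \<open>\<nat>\<close> with finite support.
\<close>

lemma sprod_eq:
  assumes "perm s = perm t"
  shows "sprod s = sprod t"
proof -
  \<comment> \<open>It suffices to treat the trivial permutation, since the products are invertible.\<close>
  have "perm (s @ rev t) = id" using assms perm_rev by (simp add: perm_append)
  moreover obtain n where "set (s @ rev t) \<subseteq> {..<n}"
    by (metis finite_nat_set_iff_bounded finite_set lessThan_iff subsetI)
  ultimately have "sprod (s @ rev t) = 1" using sprod_trivial by blast
  then have "sprod s * (sprod (rev t) * sprod t) = sprod t"
    by (simp add: sprod_append flip: mult.assoc)
  then show ?thesis by (simp add: sprod_rev')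
qed

text \<open>
  Composing with a suitable cycle makes the largest moved number a fixed point.
\<close>

lemma perm_onto:
  assumes "p permutes {..<n}"
  shows "\<exists>s. p = perm s"
  using assms
proof (induction n arbitrary: p)
  case 0
  then have "p = perm []" by simp
  then show ?case by blast
next
  case (Suc n)
  obtain k where k: "p k = n" using permutes_surj[OF Suc.prems] by (metis surjD)
  have "k \<le> n" using k Suc.prems by (metis lessThan_iff less_Suc_eq_le lessI permutes_in_image)
  define q where "q = p \<circ> perm (rev (descending n k))"
  have "perm (rev (descending n k)) n = k"
    using perm_rev'[of "descending n k"] perm_descending[OF \<open>k \<le> n\<close>] by (metis comp_apply id_apply)
  then have qn: "q n = n" by (simp add: q_def k)
  have above: "q m = m" if "n < m" for m
    using that Suc.prems perm_above[of "rev (descending n k)" n m]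
    by (simp add: q_def permutes_def subset_eq)
  have "bij q" unfolding q_def
    using Suc.prems bij_perm permutes_bij bij_comp by blast
  then have "q permutes {..<n}"
    using qn above by (auto simp: permutes_def bij_iff not_less le_less)
  then obtain s where "q = perm s" using Suc.IH by blast
  then have "perm (s @ descending n k) = p \<circ> (perm (rev (descending n k)) \<circ> perm (descending n k))"
    by (simp only: perm_append q_def comp_assoc flip: \<open>q = perm s\<close>)
  then show ?case by (metis comp_id perm_rev')
qed

section \<open>Trees of divisions of one square\<close>

text \<open>
  The left subtree of a node describes the left or bottom half.
\<close>

datatype tree = Leaf | Node dir tree tree

text \<open>
  The halvings that produce the tree inside the rectangle numbered \<open>m\<close>. The second half comes
  first, so that the number of the first half is still \<open>m\<close> when its turn comes.
\<close>

fun tree_el :: "nat \<Rightarrow> tree \<Rightarrow> word_monoid" where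
  "tree_el m Leaf = 1"
| "tree_el m (Node x l r) = D x m * (tree_el (Suc m) r * tree_el m l)"

text \<open>
  In this and the following commutation rules, the trailing factor \<open>z\<close> allows the rule to
  rewrite in the middle of a right-nested product.
\<close>

lemma D_D_left: "i < j \<Longrightarrow> D x i * (D y (Suc j) * z) = D y j * (D x i * z)"
  using D_D[of i j y x] by (metis mult.assoc)

lemma D_tree_el: "i < m \<Longrightarrow> D x i * (tree_el (Suc m) T * z) = tree_el m T * (D x i * z)"
  by (induction T arbitrary: m z) (simp_all add: mult.assoc D_D_left)

lemma S_D_below_left: "Suc j < i \<Longrightarrow> S j * (D x i * z) = D x i * (S j * z)"
  using S_D_below by (metis mult.assoc)

lemma S_D_above_left: "i < j \<Longrightarrow> S j * (D x i * z) = D x i * (S (Suc j) * z)"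
  using S_D_above by (metis mult.assoc)

lemma S_tree_el_below: "Suc j < m \<Longrightarrow> S j * (tree_el m T * z) = tree_el m T * (S j * z)"
  by (induction T arbitrary: m z) (simp_all add: mult.assoc S_D_below_left)

lemma S_tree_el_above: "m < j \<Longrightarrow> \<exists>k>m. \<forall>z. S j * (tree_el m T * z) = tree_el m T * (S k * z)"
proof (induction T arbitrary: m j)
  case Leaf
  then show ?case by auto
next
  case (Node x l r)
  obtain k where k: "Suc m < k" "\<And>z. S (Suc j) * (tree_el (Suc m) r * z)
      = tree_el (Suc m) r * (S k * z)"
    using Node.IH(2)[of "Suc m" "Suc j"] Node.prems by auto
  obtain k' where k': "m < k'" "\<And>z. S k * (tree_el m l * z) = tree_el m l * (S k' * z)"
    using Node.IH(1)[of m k] k(1) by auto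
  show ?case
    using Node.prems k k' by (intro exI[of _ k']) (simp add: mult.assoc S_D_above_left)
qed

text \<open>
  The subgroup generated by the transpositions of numbers \<open>\<ge> m\<close>. The bound guarantees that an
  element can be moved past a tree standing at a smaller number.
\<close>

definition swaps_from :: "nat \<Rightarrow> word_monoid set" where
  "swaps_from m = sprod ` {s. set s \<subseteq> {m..}}"

lemma swaps_from_one [simp]: "1 \<in> swaps_from m"
  unfolding swaps_from_def by (rule image_eqI[of _ _ "[]"]) auto

lemma swaps_from_S: "m \<le> j \<Longrightarrow> S j \<in> swaps_from m"
  unfolding swaps_from_def by (rule image_eqI[of _ _ "[j]"]) (auto simp: sprod_Cons)

lemma swaps_from_mult: "a \<in> swaps_from m \<Longrightarrow> b \<in> swaps_from m \<Longrightarrow> a * b \<in> swaps_from m"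
  unfolding swaps_from_def
      by (clarsimp simp: image_iff) (metis Un_subset_iff set_append sprod_append)

lemma swaps_from_mono: "a \<in> swaps_from n \<Longrightarrow> m \<le> n \<Longrightarrow> a \<in> swaps_from m"
  unfolding swaps_from_def by fastforce

lemma swaps_from_inverse: "a \<in> swaps_from m \<Longrightarrow> \<exists>b\<in>swaps_from m. a * b = 1"
  unfolding swaps_from_def using sprod_rev by (clarsimp simp: image_iff) (metis set_rev)

lemma swaps_from_tree_el:
  assumes "a \<in> swaps_from (Suc m)"
  shows "\<exists>b\<in>swaps_from (Suc m). a * tree_el m T = tree_el m T * b"
proof -
  obtain s where "set s \<subseteq> {Suc m..}" "a = sprod s"
    using assms by (auto simp: swaps_from_def)
  then show ?thesis
  proof (induction s arbitrary: a)
    case Nil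
    then show ?case by (intro bexI[of _ 1]) simp_all
  next
    case (Cons j s)
    then obtain b where b: "b \<in> swaps_from (Suc m)" "sprod s * tree_el m T
        = tree_el m T * b" by auto
    obtain k where k: "m < k" "\<And>z. S j * (tree_el m T * z) = tree_el m T * (S k * z)"
      using S_tree_el_above[of m j T] Cons.prems by auto
    have "a * tree_el m T = tree_el m T * (S k * b)"
      by (simp add: Cons.prems sprod_Cons mult.assoc b k)
    moreover have "S k * b \<in> swaps_from (Suc m)" using k b
        by (intro swaps_from_mult swaps_from_S) auto
    ultimately show ?case by blast
  qed
qed

text \<open>
  The tree divides the rectangle that had the number \<open>j + 1\<close> before the exchange. It can be
  divided first, after which the undivided rectangle is moved behind the pieces.
\<close>

lemma S_tree_el_first: "\<exists>a\<in>swaps_from j. S j * tree_el j T = tree_el (Suc j) T * a"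
proof (induction T arbitrary: j)
  case Leaf
  then show ?case using swaps_from_S by simp
next
  case (Node x l r)
  obtain a where a: "a \<in> swaps_from (Suc j)" "S (Suc j) * tree_el (Suc j) r
      = tree_el (Suc (Suc j)) r * a"
    using Node.IH by blast
  obtain a' where a': "a' \<in> swaps_from (Suc j)" "a * tree_el j l = tree_el j l * a'"
    using swaps_from_tree_el a by blast
  obtain b where b: "b \<in> swaps_from j" "S j * tree_el j l = tree_el (Suc j) l * b"
    using Node.IH by blast
  have "S j * tree_el j (Node x l r)
      = D x (Suc j) * (S j * (S (Suc j) * tree_el (Suc j) r * tree_el j l))"
    using S_D_first[of j x] by (simp flip: mult.assoc)
  also have "\<dots> = D x (Suc j) * (tree_el (Suc (Suc j)) r * (S j * tree_el j l * a'))"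
    by (simp add: a a' mult.assoc S_tree_el_below)
  also have "\<dots> = tree_el (Suc j) (Node x l r) * (b * a')"
    by (simp add: b mult.assoc)
  finally show ?case using swaps_from_mult[OF b(1) swaps_from_mono[OF a'(1)]] by auto
qed

text \<open>
  Both rectangles may be divided: the two trees change places, at the cost of a permutation of
  their leaves.
\<close>

lemma swap_blocks: "\<exists>a\<in>swaps_from j. S j * (tree_el (Suc j) T * tree_el j U)
    = tree_el (Suc j) U * (tree_el j T * a)"
proof (induction T arbitrary: j)
  case Leaf
  then show ?case using S_tree_el_first by simp
next
  case (Node x l r)
  obtain a where a: "a \<in> swaps_from j" "S j * (tree_el (Suc j) l * tree_el j U)
      = tree_el (Suc j) U * (tree_el j l * a)"
    using Node.IH(1) by blast
  obtain b where b: "b \<in> swaps_from (Suc j)"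
      "S (Suc j) * (tree_el (Suc (Suc j)) r * tree_el (Suc j) U)
          = tree_el (Suc (Suc j)) U * (tree_el (Suc j) r * b)"
    using Node.IH(2) by blast
  obtain b' where b': "b' \<in> swaps_from (Suc j)" "b * tree_el j l = tree_el j l * b'"
    using swaps_from_tree_el b by blast
  have "S j * (tree_el (Suc j) (Node x l r) * tree_el j U)
      = D x j * (S (Suc j) * (S j * (tree_el (Suc (Suc j)) r * (tree_el (Suc j) l * tree_el j U))))"
    using S_D_second[of j x] by (simp flip: mult.assoc)
  also have "\<dots> = D x j * (S (Suc j) * (tree_el (Suc (Suc j)) r * tree_el (Suc j) U)
      * (tree_el j l * a))"
    by (simp add: S_tree_el_below a mult.assoc)
  also have "\<dots> = D x j * (tree_el (Suc (Suc j)) U * (tree_el (Suc j) r * (b * tree_el j l * a)))"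
    by (simp add: b mult.assoc)
  also have "\<dots> = tree_el (Suc j) U * (tree_el j (Node x l r) * (b' * a))"
    by (simp add: b' mult.assoc D_tree_el)
  finally show ?case using swaps_from_mult[OF swaps_from_mono[OF b'(1)] a(1)] by auto
qed

fun push :: "dir \<Rightarrow> bool \<Rightarrow> bool list \<times> bool list \<Rightarrow> bool list \<times> bool list" where
  "push Ver b (u, v) = (b # u, v)"
| "push Hor b (u, v) = (u, b # v)"

fun coord :: "dir \<Rightarrow> bool list \<times> bool list \<Rightarrow> bool list" where
  "coord Ver (u, v) = u"
| "coord Hor (u, v) = v"

fun leaves :: "tree \<Rightarrow> (bool list \<times> bool list) list" where
  "leaves Leaf = [([], [])]"
| "leaves (Node x l r) = map (push x False) (leaves l) @ map (push x True) (leaves r)"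

lemma coord_push: "coord x (push y b p) = (if x = y then b # coord x p else coord x p)"
  by (cases p; cases x; cases y) simp_all

lemma push_eq_iff: "push x b p = push x b' q \<longleftrightarrow> b = b' \<and> p = q"
  by (cases p; cases q; cases x) auto

lemma push_commute: "x \<noteq> y \<Longrightarrow> push x b (push y b' p) = push y b' (push x b p)"
  by (cases p; cases x; cases y) simp_all

text \<open>
  Equality up to renumbering the leaves. The set of leaves is an invariant of the rewriting and
  is recorded so that the leaves of a rewritten tree, and thereby those of its subtrees, are
  known.
\<close>

definition tree_equiv :: "tree \<Rightarrow> tree \<Rightarrow> bool"  (infix "\<approx>" 50) where
  "T \<approx> U \<longleftrightarrow> set (leaves T) = set (leaves U) \<and> (\<forall>m. \<exists>a\<in>swaps_from m. tree_el m T = tree_el m U * a)"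

lemma tree_equiv_refl: "T \<approx> T"
  unfolding tree_equiv_def by (metis swaps_from_one mult_1_right)

lemma tree_equiv_sym: "T \<approx> U \<Longrightarrow> U \<approx> T"
  unfolding tree_equiv_def by (metis swaps_from_inverse mult.assoc mult_1_right)

lemma tree_equiv_trans: "T \<approx> U \<Longrightarrow> U \<approx> V \<Longrightarrow> T \<approx> V"
  unfolding tree_equiv_def by (metis swaps_from_mult mult.assoc)

text \<open>
  The renumbering of the right subtree affects only numbers \<open>> m\<close>, and it can be moved past the
  left subtree.
\<close>

lemma tree_equiv_Node:
  assumes "l \<approx> l'" "r \<approx> r'"
  shows "Node x l r \<approx> Node x l' r'"
proof -
  have "\<exists>c\<in>swaps_from m. tree_el m (Node x l r) = tree_el m (Node x l' r') * c" for m
  proof -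
    obtain a b where a: "a \<in> swaps_from m" "tree_el m l = tree_el m l' * a"
      and b: "b \<in> swaps_from (Suc m)" "tree_el (Suc m) r = tree_el (Suc m) r' * b"
      using assms unfolding tree_equiv_def by meson
    obtain b' where b': "b' \<in> swaps_from (Suc m)" "b * tree_el m l' = tree_el m l' * b'"
      using swaps_from_tree_el b by blast
    have "tree_el m (Node x l r) = D x m * (tree_el (Suc m) r' * (b * tree_el m l' * a))"
      by (simp add: a b mult.assoc)
    also have "\<dots> = tree_el m (Node x l' r') * (b' * a)"
      by (simp add: b' mult.assoc)
    finally show ?thesis using swaps_from_mult[OF swaps_from_mono[OF b'(1)] a(1)] by auto
  qed
  moreover have "set (leaves (Node x l r)) = set (leaves (Node x l' r'))"
    using assms by (simp add: tree_equiv_def)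
  ultimately show ?thesis by (simp add: tree_equiv_def)
qed

text \<open>
  Relation \<open>R6\<close> for four arbitrary subtrees. The subtrees are moved out of the way of the three
  top nodes, \<open>R6\<close> is applied to these, and the transposition that it produces exchanges the
  subtrees \<open>b\<close> and \<open>c\<close>, which are the second and third quarter.
\<close>

lemma tree_equiv_cross_Ver:
  "Node Ver (Node Hor a b) (Node Hor c d) \<approx> Node Hor (Node Ver a c) (Node Ver b d)"
proof -
  have "\<exists>e\<in>swaps_from m. tree_el m (Node Ver (Node Hor a b) (Node Hor c d))
      = tree_el m (Node Hor (Node Ver a c) (Node Ver b d)) * e" for m
  proof -
    obtain e where e: "e \<in> swaps_from (Suc m)"
        "S (Suc m) * (tree_el (Suc (Suc m)) c * tree_el (Suc m) b)
            = tree_el (Suc (Suc m)) b * (tree_el (Suc m) c * e)"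
      using swap_blocks by blast
    obtain e' where e': "e' \<in> swaps_from (Suc m)" "e * tree_el m a = tree_el m a * e'"
      using swaps_from_tree_el e by blast
    have "tree_el m (Node Ver (Node Hor a b) (Node Hor c d)) = D Ver m * (D Hor (Suc m) * D Hor m)
        * (tree_el (Suc (Suc (Suc m))) d * (tree_el (Suc (Suc m)) c
            * (tree_el (Suc m) b * tree_el m a)))"
      by (simp add: mult.assoc D_tree_el)
    also have "\<dots> = D Hor m * (D Ver (Suc m) * (D Ver m *
        (tree_el (Suc (Suc (Suc m))) d * (S (Suc m)
            * (tree_el (Suc (Suc m)) c * tree_el (Suc m) b) * tree_el m a))))"
      by (simp add: D_cross mult.assoc S_tree_el_below)
    also have "\<dots> = D Hor m * (D Ver (Suc m) * (D Ver m *
        (tree_el (Suc (Suc (Suc m))) d * (tree_el (Suc (Suc m)) b * (tree_el (Suc m) c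
            * (e * tree_el m a))))))"
      by (simp add: e mult.assoc)
    also have "\<dots> = tree_el m (Node Hor (Node Ver a c) (Node Ver b d)) * e'"
      by (simp add: e' mult.assoc D_tree_el)
    finally show ?thesis using e'(1) swaps_from_mono by fastforce
  qed
  moreover have "set (leaves (Node Ver (Node Hor a b) (Node Hor c d)))
      = set (leaves (Node Hor (Node Ver a c) (Node Ver b d)))"
    by (auto simp: push_commute image_Un image_image)
  ultimately show ?thesis by (simp add: tree_equiv_def)
qed

lemma tree_equiv_cross:
  assumes "x \<noteq> y"
  shows "Node y (Node x a b) (Node x c d) \<approx> Node x (Node y a c) (Node y b d)"
  using assms tree_equiv_cross_Ver tree_equiv_sym by (cases x; cases y) auto

text \<open>
  The leaf coordinates in direction \<open>x\<close> are all nonempty exactly if the middle line of direction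
  \<open>x\<close> cuts no rectangle. This property passes to the subtrees of a node of the other direction,
  and these thereby get roots of direction \<open>x\<close>, which are exchanged with the node by \<open>R6\<close>.
\<close>

lemma divisible_tree:
  assumes "\<forall>p\<in>set (leaves T). coord x p \<noteq> []"
  shows "\<exists>l r. T \<approx> Node x l r"
  using assms
proof (induction T)
  case Leaf
  then show ?case by (cases x) auto
next
  case (Node y l r)
  show ?case
  proof (cases "x = y")
    case True
    then show ?thesis using tree_equiv_refl by blast
  next
    case False
    then obtain a b c d where "l \<approx> Node x a b" "r \<approx> Node x c d"
      using Node by (fastforce simp: ball_Un coord_push)
    then have "Node y l r \<approx> Node y (Node x a b) (Node x c d)"
      by (rule tree_equiv_Node)
    then show ?thesis using tree_equiv_cross[OF False] tree_equiv_trans by blast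
  qed
qed

lemma leaves_Node_inject:
  assumes "set (leaves (Node x l r)) = set (leaves (Node x l' r'))"
  shows "set (leaves l) = set (leaves l')" "set (leaves r) = set (leaves r')"
proof -
  have l: "p \<in> set (leaves l) \<longleftrightarrow> push x False p \<in> set (leaves (Node x l r))"
    and r: "p \<in> set (leaves r) \<longleftrightarrow> push x True p \<in> set (leaves (Node x l r))" for p l r
    by (auto simp: image_iff push_eq_iff)
  show "set (leaves l) = set (leaves l')"
    by (rule Set.set_eqI) (simp only: l[of _ l r] l[of _ l' r'] assms)
  show "set (leaves r) = set (leaves r')"
    by (rule Set.set_eqI) (simp only: r[of _ r l] r[of _ r' l'] assms)
qed

text \<open>
  Once the second tree has been given the root direction of the first, the leaves of the two
  halves are determined by the leaves of the whole, and induction applies to the halves.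
\<close>

lemma tree_equiv_if_leaves_eq:
  assumes "set (leaves T) = set (leaves U)"
  shows "T \<approx> U"
  using assms
proof (induction T arbitrary: U)
  case Leaf
  \<comment> \<open>The leaf with empty coordinates is not below any node.\<close>
  have "U = Leaf"
  proof (cases U)
    case (Node x l r)
    then have "\<forall>p\<in>set (leaves U). coord x p \<noteq> []" by (auto simp: coord_push)
    moreover have "([], []) \<in> set (leaves U)" using Leaf
        by (metis leaves.simps(1) list.set_intros(1))
    ultimately show ?thesis by (cases x) auto
  qed
  then show ?case by (simp add: tree_equiv_refl)
next
  case (Node x l r)
  have "\<forall>p\<in>set (leaves U). coord x p \<noteq> []"
    unfolding Node.prems[symmetric] by (auto simp: coord_push)
  then obtain l' r' where U: "U \<approx> Node x l' r'" using divisible_tree by blast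
  then have "set (leaves (Node x l r)) = set (leaves (Node x l' r'))"
    using Node.prems by (metis tree_equiv_def)
  then have "l \<approx> l'" "r \<approx> r'"
    using Node.IH(1)[OF leaves_Node_inject(1)] Node.IH(2)[OF leaves_Node_inject(2)] by simp_all
  then have "Node x l r \<approx> Node x l' r'" by (rule tree_equiv_Node)
  then show ?case using U tree_equiv_sym tree_equiv_trans by blast
qed

section \<open>Forests and normal forms\<close>

text \<open>
  The trees are grown from right to left, for the same reason as in \<^const>\<open>tree_el\<close>. Beyond the end
  of the list all trees are leaves.
\<close>

fun forest_el :: "nat \<Rightarrow> tree list \<Rightarrow> word_monoid" where
  "forest_el m [] = 1"
| "forest_el m (T # Ts) = forest_el (Suc m) Ts * tree_el m T"

lemma D_forest_el_Suc: "i < m \<Longrightarrow> D x i * (forest_el (Suc m) Ts * z) = forest_el m Ts * (D x i * z)"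
  by (induction Ts arbitrary: m z) (simp_all add: mult.assoc D_tree_el)

text \<open>
  An initial halving of \<open>S\<^sub>i\<close> joins the trees that used to stand at \<open>i\<close> and \<open>i + 1\<close> under a new
  root, because \<open>R1\<close> moves the halving past all trees further to the right.
\<close>

lemma D_forest_el: "\<exists>Us. D x (m + k) * forest_el m Ts = forest_el m Us"
proof (induction k arbitrary: m Ts)
  case 0
  consider "Ts = []" | T where "Ts = [T]" | T U R where "Ts = T # U # R"
    by (metis list.exhaust)
  then show ?case
  proof cases
    case 1
    \<comment> \<open>The trees that are missing from the list are leaves.\<close>
    then show ?thesis by (intro exI[of _ "[Node x Leaf Leaf]"]) simp
  next
    case 2
    then show ?thesis by (intro exI[of _ "[Node x T Leaf]"]) simp
  next
    case 3
    then show ?thesis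
      by (intro exI[of _ "Node x T U # R"]) (simp add: D_forest_el_Suc mult.assoc)
  qed
next
  case (Suc k)
  show ?case
  proof (cases Ts)
    case Nil
    obtain Us where "D x (Suc m + k) * forest_el (Suc m) [] = forest_el (Suc m) Us"
        using Suc by blast
    then show ?thesis using Nil by (intro exI[of _ "Leaf # Us"]) simp
  next
    case (Cons T R)
    obtain Us where "D x (Suc m + k) * forest_el (Suc m) R = forest_el (Suc m) Us"
        using Suc by blast
    then show ?thesis
      using Cons by (intro exI[of _ "T # Us"]) (simp flip: mult.assoc)
  qed
qed

inductive_set positive :: "word_monoid set" where
  one: "1 \<in> positive"
| step: "a \<in> positive \<Longrightarrow> D x i * a \<in> positive"

lemma positive_forest_el: "a \<in> positive \<Longrightarrow> \<exists>Ts. a = forest_el 0 Ts"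
proof (induction rule: positive.induct)
  case one
  then show ?case by (metis forest_el.simps(1))
next
  case (step a x i)
  then show ?case using D_forest_el[of x 0 i] by auto
qed

lemma S_D: "\<exists>i' s. S j * D x i = D x i' * sprod s"
proof -
  consider "i < j" | "i = j" | "i = Suc j" | "Suc j < i" by linarith
  then show ?thesis
  proof cases
    case 1
    then have "S j * D x i = D x i * sprod [Suc j]" by (simp add: sprod_Cons S_D_above)
    then show ?thesis by blast
  next
    case 2
    then have "S j * D x i = D x (Suc j) * sprod [j, Suc j]" by (simp add: sprod_Cons S_D_first)
    then show ?thesis by blast
  next
    case 3
    then have "S j * D x i = D x j * sprod [Suc j, j]" by (simp add: sprod_Cons S_D_second)
    then show ?thesis by blast
  next
    case 4
    then have "S j * D x i = D x i * sprod [j]" by (simp add: sprod_Cons S_D_below)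
    then show ?thesis by blast
  qed
qed

lemma sprod_D: "\<exists>i' t. sprod s * D x i = D x i' * sprod t"
proof (induction s)
  case Nil
  have "sprod [] * D x i = D x i * sprod []" by simp
  then show ?case by blast
next
  case (Cons j s)
  then obtain i' t where t: "sprod s * D x i = D x i' * sprod t" by blast
  obtain k u where u: "S j * D x i' = D x k * sprod u" using S_D by blast
  have "sprod (j # s) * D x i = D x k * sprod (u @ t)"
    by (simp add: sprod_Cons sprod_append mult.assoc t) (simp add: u flip: mult.assoc)
  then show ?case by blast
qed

text \<open>
  Moving transpositions to the right past halvings changes the numbers of the halvings and the
  transpositions, but not the shape of the product.
\<close>

lemma sprod_positive:
  assumes "a \<in> positive"
  shows "\<exists>b\<in>positive. \<exists>t. sprod s * a = b * sprod t"
  using assms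
proof (induction arbitrary: s rule: positive.induct)
  case one
  have "sprod s * 1 = 1 * sprod s" by simp
  then show ?case using positive.one by blast
next
  case (step a x i)
  obtain i' t where t: "sprod s * D x i = D x i' * sprod t" using sprod_D by blast
  obtain b u where u: "b \<in> positive" "sprod t * a = b * sprod u" using step.IH by blast
  have "sprod s * (D x i * a) = D x i' * (sprod t * a)"
    by (simp add: t flip: mult.assoc)
  also have "\<dots> = (D x i' * b) * sprod u" by (simp add: u mult.assoc)
  finally show ?case using positive.step[OF u(1)] by blast
qed

lemma cls_positive: "\<exists>a\<in>positive. \<exists>s. cls w = a * sprod s"
proof (induction w)
  case Nil
  have "cls [] = 1 * sprod []" by simp
  then show ?case using positive.one by blast
next
  case (Cons g w)
  then obtain a s where a: "a \<in> positive" "cls w = a * sprod s" by blast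
  show ?case
  proof (cases g)
    case (Div x i)
    then have "cls (g # w) = (D x i * a) * sprod s"
      by (simp add: cls_Cons[of "Div x i" w] D_def a mult.assoc)
    then show ?thesis using positive.step[OF a(1)] by blast
  next
    case (Swap j)
    obtain b t where b: "b \<in> positive" "sprod [j] * a = b * sprod t"
      using sprod_positive[OF a(1)] by blast
    have "cls (g # w) = sprod [j] * a * sprod s"
      by (simp add: cls_Cons[of "Swap j" w] Swap S_def sprod_Cons a mult.assoc)
    also have "\<dots> = b * sprod (t @ s)" by (simp add: b sprod_append mult.assoc)
    finally show ?thesis using b(1) by blast
  qed
qed

text \<open>
  Transpositions go to the right first; the halvings that remain are then sorted into trees.
\<close>

lemma forest_normal_form: "\<exists>Ts s. a = forest_el 0 Ts * sprod s"
proof -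
  obtain w where "a = cls w" by transfer (use word_cong.refl in blast)
  then show ?thesis using cls_positive positive_forest_el by blast
qed

section \<open>The numbering determines the element\<close>

lift_definition numbering :: "word_monoid \<Rightarrow> nat \<Rightarrow> address" is word_numbering
  by (rule word_numbering_cong)

lemma numbering_cls: "numbering (cls w) = word_numbering w"
  by transfer simp

lemma numbering_one [simp]: "numbering 1 = triv"
  by transfer simp

lemma numbering_mult: "numbering (a * b) = numbering a \<star> numbering b"
  by transfer (rule word_numbering_append)

lemma numbering_D: "numbering (D x i) = gen_numbering (Div x i)"
  by (simp add: D_def numbering_cls word_numbering_Cons)

lemma numbering_sprod: "numbering (sprod s) = triv \<circ> perm s"
  by (simp add: sprod_def numbering_cls word_numbering_Swap)

lemma star_perm: "C \<star> (triv \<circ> p) = C \<circ> p"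
  by (simp add: star_def fun_eq_iff)

lemma triv_refine: "refine (triv m) (m, p) = (m, p)"
  by (cases p) (simp add: triv_def)

lemma half_triv_refine: "refine (half x b (triv m)) (k, p) = (m, push x b p)"
  by (cases x; cases p) (simp_all add: triv_def)

lemma leaves_not_Nil [simp]: "leaves T \<noteq> []"
  by (induction T) simp_all

lemma numbering_tree_el:
  "numbering (tree_el m T) n =
    (if n < m then triv n else if n < m + length (leaves T) then (m, leaves T ! (n - m))
     else triv (Suc n - length (leaves T)))"
proof (induction T arbitrary: m n)
  case Leaf
  then show ?case by (auto simp: triv_def)
next
  case (Node x l r)
  define L R where "L = length (leaves l)" and "R = length (leaves r)"
  have pos: "0 < L" "0 < R" by (simp_all add: L_def R_def)
  note IH = Node.IH[folded L_def R_def]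
  have len: "length (leaves (Node x l r)) = L + R" by (simp add: L_def R_def)
  consider "n < m" | "m \<le> n" "n < m + L" | "m + L \<le> n" "n < m + L + R" | "m + L + R \<le> n"
    by linarith
  then show ?case
  proof cases
    case 1
    then show ?thesis by (simp add: numbering_mult numbering_D star_def IH)
  next
    case 2
    then have "n - m < L" by linarith
    with 2 show ?thesis
      unfolding len
      by (simp add: numbering_mult numbering_D star_def IH triv_refine half_triv_refine nth_append
          flip: L_def)
  next
    case 3
    then have "\<not> n < m + L" "\<not> n - m < L" "Suc m \<le> Suc n - L" "Suc n - L < Suc m + R" by linarith+
    moreover have "Suc n - L - Suc m = n - m - L" by linarith
    ultimately show ?thesis
      using 3 unfolding len
      by (simp add: numbering_mult numbering_D star_def IH half_triv_refine nth_append R_def flip: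
          L_def)
  next
    case 4
    then have "\<not> n < m + L" "\<not> n < m" "\<not> Suc n - L < Suc m" "\<not> Suc n - L < Suc m + R"
      using pos by linarith+
    moreover have "\<not> Suc (Suc n - L) - R < Suc (Suc m)" using 4 pos by linarith
    moreover have "Suc (Suc n - L) - R - 1 = Suc n - (L + R)" using 4 pos by linarith
    ultimately show ?thesis
      using 4 unfolding len
      by (simp add: numbering_mult numbering_D star_def IH)
  qed
qed

lemma distinct_leaves: "distinct (leaves T)"
proof (induction T)
  case (Node x l r)
  then show ?case by (auto simp: distinct_map inj_on_def push_eq_iff)
qed simp

text \<open>
  The addresses of the pattern of a forest, in the squares from \<open>m\<close> on.
\<close>

fun addresses :: "nat \<Rightarrow> tree list \<Rightarrow> address set" where
  "addresses m [] = triv ` {m..}"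
| "addresses m (T # Ts) = {m} \<times> set (leaves T) \<union> addresses (Suc m) Ts"

lemma addresses_fst: "c \<in> addresses m Ts \<Longrightarrow> m \<le> fst c"
  by (induction Ts arbitrary: m) (fastforce simp: Suc_le_eq)+

lemma numbering_forest_el_below: "n < m \<Longrightarrow> numbering (forest_el m Ts) n = triv n"
  by (induction Ts arbitrary: m) (simp_all add: numbering_mult star_def numbering_tree_el)

lemma numbering_forest_el_Cons:
  assumes "m \<le> n"
  shows "numbering (forest_el m (T # Ts)) n =
    (if n < m + length (leaves T) then (m, leaves T ! (n - m))
     else numbering (forest_el (Suc m) Ts) (Suc n - length (leaves T)))"
  using assms by (auto simp: numbering_mult star_def numbering_tree_el numbering_forest_el_below
      triv_refine)

text \<open>
  The numbers from \<open>m\<close> on split into those of the leaves of the first tree and the others, which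
  the remaining forest numbers after a shift by the number of additional leaves.
\<close>

lemma numbering_forest_el_image: "numbering (forest_el m Ts) ` {m..} = addresses m Ts"
proof (induction Ts arbitrary: m)
  case (Cons T Ts)
  define L where "L = length (leaves T)"
  have pos: "0 < L" by (simp add: L_def)
  \<comment> \<open>A number \<open>n > m\<close> of the remaining forest becomes \<open>n + L - 1\<close> once the first tree has \<open>L\<close>
      leaves.\<close>
  have "{m..} = (\<lambda>k. m + k) ` {..<L} \<union> (\<lambda>n. n + L - 1) ` {Suc m..}"
  proof (intro Set.set_eqI iffI)
    fix n assume "n \<in> {m..}"
    then show "n \<in> (\<lambda>k. m + k) ` {..<L} \<union> (\<lambda>n. n + L - 1) ` {Suc m..}"
      using pos by (cases "n < m + L")
        (auto intro: image_eqI[of _ _ "n - m"] image_eqI[of _ _ "Suc n - L"])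
  qed (use pos in auto)
  then have "numbering (forest_el m (T # Ts)) ` {m..}
      = (\<lambda>k. numbering (forest_el m (T # Ts)) (m + k)) ` {..<L}
        \<union> (\<lambda>n. numbering (forest_el m (T # Ts)) (n + L - 1)) ` {Suc m..}"
    by (simp only: image_Un image_image)
  also have "(\<lambda>k. numbering (forest_el m (T # Ts)) (m + k)) ` {..<L}
      = (\<lambda>k. (m, leaves T ! k)) ` {..<L}"
  proof (rule image_cong[OF HOL.refl])
    fix k assume "k \<in> {..<L}"
    then have "m \<le> m + k" "m + k < m + length (leaves T)" "m + k - m = k" by (simp_all add: L_def)
    then show "numbering (forest_el m (T # Ts)) (m + k) = (m, leaves T ! k)"
      by (simp only: numbering_forest_el_Cons if_True)
  qed
  also have "\<dots> = {m} \<times> set (leaves T)"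
    by (auto simp: L_def set_conv_nth)
  also have "(\<lambda>n. numbering (forest_el m (T # Ts)) (n + L - 1)) ` {Suc m..}
      = numbering (forest_el (Suc m) Ts) ` {Suc m..}"
  proof (rule image_cong[OF HOL.refl])
    fix n assume "n \<in> {Suc m..}"
    then have "m \<le> n + L - 1" "\<not> n + L - 1 < m + L" "Suc (n + L - 1) - L = n" using pos by auto
    then show "numbering (forest_el m (T # Ts)) (n + L - 1) = numbering (forest_el (Suc m) Ts) n"
      by (simp add: numbering_forest_el_Cons flip: L_def del: forest_el.simps)
  qed
  finally show ?case by (simp add: Cons.IH)
qed simp

lemma range_numbering_forest_el: "range (numbering (forest_el 0 Ts)) = addresses 0 Ts"
  using numbering_forest_el_image[of 0 Ts] by (simp add: atLeast_0)

lemma inj_on_numbering_forest_el: "inj_on (numbering (forest_el m Ts)) {m..}"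
proof (induction Ts arbitrary: m)
  case Nil
  then show ?case by (auto simp: inj_on_def triv_def)
next
  case (Cons T Ts)
  define L where "L = length (leaves T)"
  have pos: "0 < L" by (simp add: L_def)
  define C where "C = numbering (forest_el m (T # Ts))"
  define E where "E = numbering (forest_el (Suc m) Ts)"
  have C: "C n = (if n < m + L then (m, leaves T ! (n - m)) else E (Suc n - L))" if "m \<le> n" for n
    using that by (simp only: C_def E_def L_def numbering_forest_el_Cons)
  have E: "Suc m \<le> fst (E n)" if "Suc m \<le> n" for n
    using that numbering_forest_el_image[of "Suc m" Ts] addresses_fst[of "E n" "Suc m" Ts]
    by (auto simp: E_def)
  show ?case
    unfolding C_def[symmetric]
  proof (rule linorder_inj_onI')
    fix n k assume n: "n \<in> {m..}" "k \<in> {m..}" "n < k"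
    consider "k < m + L" | "n < m + L" "m + L \<le> k" | "m + L \<le> n" by linarith
    then show "C n \<noteq> C k"
    proof cases
      case 1
      then show ?thesis
        using n distinct_leaves[of T] by (auto simp: C nth_eq_iff_index_eq L_def)
    next
      case 2
      then have "fst (C n) = m" "Suc m \<le> fst (C k)" using n by (simp_all add: C E)
      then show ?thesis by auto
    next
      case 3
      then have "C n = E (Suc n - L)" "C k = E (Suc k - L)" using n by (simp_all add: C)
      moreover have "Suc n - L \<noteq> Suc k - L" "Suc n - L \<in> {Suc m..}" "Suc k - L \<in> {Suc m..}"
        using 3 n pos by auto
      ultimately show ?thesis using Cons.IH[of "Suc m"] by (auto simp: E_def inj_on_def)
    qed
  qed
qed

text \<open>
  Trailing leaves make two forests comparable tree by tree.
\<close>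

lemma forest_el_pad: "forest_el m (Ts @ replicate k Leaf) = forest_el m Ts"
proof (induction Ts arbitrary: m)
  case Nil
  show ?case by (induction k arbitrary: m) simp_all
qed simp

lemma addresses_pad: "addresses m (Ts @ replicate k Leaf) = addresses m Ts"
proof (induction Ts arbitrary: m)
  case Nil
  show ?case
  proof (induction k arbitrary: m)
    case (Suc k)
    have "{m..} = insert m {Suc m..}" by auto
    then show ?case using Suc[of "Suc m"] by (simp add: triv_def)
  qed simp
qed simp

text \<open>
  The set of addresses determines the set of leaves of each tree, hence each tree up to a
  renumbering; the renumberings of the trees further to the right commute with the present one
  up to a shift.
\<close>

lemma forest_el_eq_length:
  assumes "length Ts = length Us" "addresses m Ts = addresses m Us"
  shows "\<exists>a\<in>swaps_from m. forest_el m Ts = forest_el m Us * a"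
  using assms
proof (induction Ts Us arbitrary: m rule: list_induct2)
  case Nil
  then show ?case by (intro bexI[of _ 1]) simp_all
next
  case (Cons T Ts U Us)
  have "p \<in> set (leaves T) \<longleftrightarrow> (m, p) \<in> addresses m (T # Ts)" for T Ts p
    using addresses_fst[of "(m, p)" "Suc m" Ts] by auto
  then have "set (leaves T) = set (leaves U)" using Cons.prems by blast
  then have "T \<approx> U" by (rule tree_equiv_if_leaves_eq)
  then obtain a where a: "a \<in> swaps_from m" "tree_el m T = tree_el m U * a"
    unfolding tree_equiv_def by blast
  have "addresses (Suc m) Ts = {c \<in> addresses m (T # Ts). fst c \<noteq> m}" for T Ts
  proof -
    have "fst c \<noteq> m" if "c \<in> addresses (Suc m) Ts" for c using addresses_fst[OF that] by simp
    then show ?thesis by auto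
  qed
  note tail = this[of Ts T] this[of Us U]
  have "addresses (Suc m) Ts = addresses (Suc m) Us" by (simp only: tail Cons.prems)
  then obtain b where b: "b \<in> swaps_from (Suc m)" "forest_el (Suc m) Ts = forest_el (Suc m) Us * b"
    using Cons.IH by blast
  obtain b' where b': "b' \<in> swaps_from (Suc m)" "b * tree_el m U = tree_el m U * b'"
    using swaps_from_tree_el b by blast
  have "forest_el m (T # Ts) = forest_el (Suc m) Us * (b * tree_el m U) * a"
      by (simp add: a b mult.assoc)
  also have "\<dots> = forest_el m (U # Us) * (b' * a)" by (simp add: b' mult.assoc)
  finally show ?case using swaps_from_mult[OF swaps_from_mono[OF b'(1)] a(1)] by auto
qed

lemma forest_el_eq:
  assumes "addresses m Ts = addresses m Us"
  shows "\<exists>a\<in>swaps_from m. forest_el m Ts = forest_el m Us * a"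
proof -
  have "\<exists>a\<in>swaps_from m. forest_el m (Ts @ replicate (length Us) Leaf)
      = forest_el m (Us @ replicate (length Ts) Leaf) * a"
    using assms by (intro forest_el_eq_length) (simp_all add: addresses_pad)
  then show ?thesis by (simp only: forest_el_pad)
qed

lemma numbering_normal_form: "numbering (forest_el 0 Ts * sprod s)
    = numbering (forest_el 0 Ts) \<circ> perm s"
  by (simp only: numbering_mult numbering_sprod star_perm)

lemma inj_numbering_forest_el: "inj (numbering (forest_el 0 Ts))"
  using inj_on_numbering_forest_el[of 0 Ts] by (simp add: atLeast_0)

lemma inj_numbering: "inj (numbering a)"
proof -
  obtain Ts s where "a = forest_el 0 Ts * sprod s" using forest_normal_form by blast
  then show ?thesis
    using inj_numbering_forest_el bij_perm
        by (simp add: numbering_normal_form bij_is_inj inj_compose)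
qed

text \<open>
  The numbering of an element determines the pattern, hence the forest up to a renumbering. With
  the same forest on both sides, what remains is an equality of permutations, because the
  numbering of a forest is injective.
\<close>

lemma numbering_inject: "numbering a = numbering b \<longleftrightarrow> a = b"
proof
  assume eq: "numbering a = numbering b"
  obtain Ts s where a: "a = forest_el 0 Ts * sprod s" using forest_normal_form by blast
  obtain Us t where b: "b = forest_el 0 Us * sprod t" using forest_normal_form by blast
  have range: "range (C \<circ> perm s) = range C" for C :: "nat \<Rightarrow> address" and s
    using bij_perm[of s] by (metis bij_is_surj image_comp)
  have "addresses 0 Ts = range (numbering a)" "addresses 0 Us = range (numbering b)"
    by (simp_all only: a b numbering_normal_form range range_numbering_forest_el)
  then obtain c where c: "c \<in> swaps_from 0" "forest_el 0 Ts = forest_el 0 Us * c"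
    using eq forest_el_eq by metis
  then obtain r where "c = sprod r" by (auto simp: swaps_from_def)
  then have a': "a = forest_el 0 Us * sprod (r @ s)" by (simp add: a c sprod_append mult.assoc)
  then have "numbering (forest_el 0 Us) \<circ> perm (r @ s) = numbering (forest_el 0 Us) \<circ> perm t"
    using eq unfolding b by (simp only: numbering_normal_form)
  then have "perm (r @ s) = perm t"
    using inj_numbering_forest_el by (metis fun.inj_map_strong injD)
  then have "sprod (r @ s) = sprod t" by (rule sprod_eq)
  then show "a = b" by (simp only: a' b)
qed simp

section \<open>Addresses as rectangles\<close>

text \<open>
  The binary fraction with the digits \<open>u\<close> after the point.
\<close>

fun val :: "bool list \<Rightarrow> real" where
  "val [] = 0"
| "val (b # u) = (of_bool b + val u) / 2"

lemma val_append: "val (u @ w) = val u + val w / 2 ^ length u"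
  by (induction u) (simp_all add: field_simps)

lemma val_nonneg: "0 \<le> val u"
  by (induction u) simp_all

lemma val_upper: "val u + 1 / 2 ^ length u \<le> 1"
proof (induction u)
  case (Cons b u)
  have "val (b # u) + 1 / 2 ^ length (b # u) = (of_bool b + (val u + 1 / 2 ^ length u)) / 2"
    by (simp add: add_divide_distrib)
  also have "\<dots> \<le> 1" using Cons by (cases b) simp_all
  finally show ?case .
qed simp

lemma val_less: "val u < 1"
proof -
  have "0 < 1 / (2::real) ^ length u" by simp
  then show ?thesis using val_upper[of u] by linarith
qed

lemma val_inject: "length u = length w \<Longrightarrow> val u = val w \<Longrightarrow> u = w"
proof (induction u w rule: list_induct2)
  case (Cons b u b' w)
  then have "b = b'"
    using val_nonneg[of u] val_nonneg[of w] val_less[of u] val_less[of w]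
    by (cases b; cases b') auto
  then show ?case using Cons by simp
qed simp

fun rect :: "address \<Rightarrow> (real \<times> real) set" where
  "rect (m, u, v) = {2 * real m + val u .. 2 * real m + val u + 1 / 2 ^ length u}
    \<times> {val v .. val v + 1 / 2 ^ length v}"

lemma rect_triv [simp]: "rect (triv n) = Sq n"
  by (simp add: triv_def Sq_def)

lemma Sq_disjoint: "z \<in> Sq n \<Longrightarrow> z \<in> Sq m \<Longrightarrow> n = m"
proof -
  have "n \<le> m" if "z \<in> Sq n" "z \<in> Sq m" for n m
  proof -
    have "real (2 * n) \<le> real (2 * m + 1)" using that by (auto simp: Sq_def)
    then show ?thesis by (simp only: of_nat_le_iff)
  qed
  then show "z \<in> Sq n \<Longrightarrow> z \<in> Sq m \<Longrightarrow> n = m" by (simp add: le_antisym)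
qed

lemma rect_not_empty: "rect c \<noteq> {}"
  by (cases c) (simp add: times_eq_iff)

lemma rect_subset: "rect c \<subseteq> Sq (fst c)"
proof (cases c)
  case (fields m u v)
  then show ?thesis
    using val_nonneg[of u] val_upper[of u] val_nonneg[of v] val_upper[of v]
    by (auto simp: Sq_def)
qed

lemma rect_subset_iff: "rect c \<subseteq> Sq i \<longleftrightarrow> fst c = i"
  using rect_not_empty[of c] rect_subset[of c] Sq_disjoint by blast

lemma box_eq:
  fixes a b c d :: real
  assumes "{a..b} \<times> {c..d} = {a'..b'} \<times> {c'..d'}" "a < b" "c < d"
  shows "a' = a" "b' = b" "c' = c" "d' = d"
  using assms by (auto simp: times_eq_iff Icc_eq_Icc)

text \<open>
  A rectangle lies in one square, its width and height give the lengths of the two lists, and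
  its lower left corner gives their digits.
\<close>

lemma rect_inject: "rect c = rect d \<longleftrightarrow> c = d"
proof
  assume eq: "rect c = rect d"
  obtain m u v where c: "c = (m, u, v)" by (metis prod.exhaust)
  obtain m' u' v' where d: "d = (m', u', v')" by (metis prod.exhaust)
  have m: "m = m'" using eq rect_subset[of c] rect_subset_iff[of d m] by (simp add: c d)
  note ends = box_eq[OF eq[unfolded c d rect.simps]]
  have "val u' = val u" "1 / (2::real) ^ length u' = 1 / 2 ^ length u"
    and "val v' = val v" "1 / (2::real) ^ length v' = 1 / 2 ^ length v"
    using ends m by simp_all
  then show "c = d" using m c d val_inject by simp
qed simp

lemma inj_rect: "inj rect"
  by (simp add: inj_def rect_inject)

section \<open>Numberings as maps of the plane\<close>

text \<open>
  The affine map of the required form that carries \<open>S\<^sub>n\<close> onto the rectangle with the given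
  address.
\<close>

fun aff :: "address \<Rightarrow> nat \<Rightarrow> real \<times> real \<Rightarrow> real \<times> real" where
  "aff (m, u, v) n (x, y) =
    (2 * real m + val u + (x - 2 * real n) / 2 ^ length u, val v + y / 2 ^ length v)"

lemma image_affine:
  fixes a p l h :: real
  assumes "0 < p"
  shows "(\<lambda>x. a + p * x) ` {l..h} = {a + p * l .. a + p * h}"
proof (intro equalityI subsetI)
  fix y assume "y \<in> {a + p * l .. a + p * h}"
  then have "(y - a) / p \<in> {l..h}" "y = a + p * ((y - a) / p)"
    using assms by (auto simp: field_simps)
  then show "y \<in> (\<lambda>x. a + p * x) ` {l..h}" by blast
qed (use assms in auto)

lemma image_affine_Sq:
  assumes "0 < p" "0 < q"
  shows "(\<lambda>(x, y). (a + p * x, b + q * y)) ` Sq n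
    = {a + p * (2 * real n) .. a + p * (2 * real n + 1)} \<times> {b .. b + q}"
proof -
  have "(\<lambda>(x, y). (a + p * x, b + q * y)) ` Sq n
      = (\<lambda>x. a + p * x) ` {2 * real n .. 2 * real n + 1} \<times> (\<lambda>y. b + q * y) ` {0..1}"
    by (auto simp: Sq_def image_iff)
  then show ?thesis using image_affine[OF assms(1)] image_affine[OF assms(2), of b 0 1] by simp
qed

lemma aff_eq:
  "aff (m, u, v) n = (\<lambda>(x, y). (2 * real m + val u - 2 * real n / 2 ^ length u
      + 2 powi (- int (length u)) * x, val v + 2 powi (- int (length v)) * y))"
  by (auto simp: fun_eq_iff power_int_minus field_simps)

lemma dyadic_affine_aff: "dyadic_affine (aff c n)"
proof (cases c)
  case (fields m u v)
  then show ?thesis unfolding dyadic_affine_def by (auto simp only: aff_eq)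
qed

lemma aff_image: "aff c n ` Sq n = rect c"
proof (cases c)
  case (fields m u v)
  show ?thesis
    unfolding fields aff_eq
    by (subst image_affine_Sq) (simp_all add: power_int_minus divide_inverse algebra_simps)
qed

text \<open>
  An affine map of the required form is determined by the image of \<open>S\<^sub>n\<close>: the side lengths of
  the image are its scale factors, and the lower left corner goes to the lower left corner.
\<close>

lemma affine_fit_rect: "affine_fit (Sq n) (rect c) = aff c n"
  unfolding affine_fit_def
proof (rule the_equality)
  show "dyadic_affine (aff c n) \<and> aff c n ` Sq n = rect c"
    by (simp add: dyadic_affine_aff aff_image)
next
  fix g assume g: "dyadic_affine g \<and> g ` Sq n = rect c"
  then obtain a b and p q :: int where gdef: "g = (\<lambda>(x, y). (a + 2 powi p * x, b + 2 powi q * y))"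
    unfolding dyadic_affine_def by blast
  obtain m u v where c: "c = (m, u, v)" by (metis prod.exhaust)
  define P Q :: real where "P = 2 powi p" and "Q = 2 powi q"
  have pos: "0 < P" "0 < Q" by (simp_all add: P_def Q_def)
  have "rect c = {a + P * (2 * real n) .. a + P * (2 * real n + 1)} \<times> {b .. b + Q}"
    using g image_affine_Sq[OF pos] by (simp add: gdef P_def Q_def)
  note ends = box_eq[OF this[unfolded c rect.simps]]
  have "a + P * (2 * real n) = 2 * real m + val u" "P = 1 / 2 ^ length u"
    "b = val v" "Q = 1 / 2 ^ length v"
    using ends by (simp_all add: algebra_simps)
  then show "g = aff c n"
    by (auto simp: gdef c fun_eq_iff field_simps simp flip: P_def Q_def)
qed

definition realize :: "(nat \<Rightarrow> address) \<Rightarrow> real \<times> real \<Rightarrow> real \<times> real" where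
  "realize C = pattern_fun (rect \<circ> C)"

lemma the_Sq: "z \<in> Sq n \<Longrightarrow> (THE i. z \<in> Sq i) = n"
  using Sq_disjoint by (blast intro: the_equality)

lemma realize_Sq: "z \<in> Sq n \<Longrightarrow> realize C z = aff (C n) n z"
  by (auto simp: realize_def pattern_fun_def XX_def the_Sq affine_fit_rect)

lemma realize_undefined: "z \<notin> XX \<Longrightarrow> realize C z = undefined"
  by (simp add: realize_def pattern_fun_def)

lemma aff_refine: "aff c (fst d) (aff d n z) = aff (refine c d) n z"
  by (cases c; cases d; cases z) (simp add: val_append power_add field_simps)

lemma aff_triv: "aff (triv n) n z = z"
  by (cases z) (simp add: triv_def)

lemma realize_star: "realize (C \<star> E) = compose XX (realize C) (realize E)"
proof
  fix z
  show "realize (C \<star> E) z = compose XX (realize C) (realize E) z"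
  proof (cases "z \<in> XX")
    case True
    then obtain n where n: "z \<in> Sq n" by (auto simp: XX_def)
    then have "aff (E n) n z \<in> Sq (fst (E n))"
      using aff_image rect_subset by blast
    then show ?thesis
      using n True by (simp add: compose_def realize_Sq aff_refine star_def)
  qed (simp add: realize_undefined compose_def)
qed

lemma realize_triv: "realize triv = (\<lambda>z\<in>XX. z)"
proof
  fix z
  show "realize triv z = (\<lambda>z\<in>XX. z) z"
    by (cases "z \<in> XX") (auto simp: XX_def realize_Sq aff_triv realize_undefined)
qed

text \<open>
  A map determines its numbering since the rectangle numbered \<open>n\<close> is the image of \<open>S\<^sub>n\<close>.
\<close>

lemma realize_inject: "realize C = realize E \<longleftrightarrow> C = E"
proof
  assume eq: "realize C = realize E"
  show "C = E"
  proof
    fix n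
    have "realize C ` Sq n = rect (C n)" for C
      using aff_image[of "C n" n] by (simp add: realize_Sq cong: image_cong)
    then show "C n = E n" using eq by (metis rect_inject)
  qed
qed simp

lemma gen_val_eq: "gen_val g = realize (gen_numbering g)"
proof -
  have "v_pat i = rect \<circ> gen_numbering (Div Ver i)" for i
    by (auto simp: fun_eq_iff v_pat_def triv_def[of i])
  moreover have "h_pat i = rect \<circ> gen_numbering (Div Hor i)" for i
    by (auto simp: fun_eq_iff h_pat_def triv_def[of i])
  moreover have "sigma_pat i = rect \<circ> gen_numbering (Swap i)" for i
    by (auto simp: fun_eq_iff sigma_pat_def transpose_def)
  ultimately show ?thesis
    by (cases g rule: gen_val.cases) (simp_all add: realize_def)
qed

section \<open>Numbered patterns are words\<close>

lemma rect_half: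
  assumes "rect c = {a..b} \<times> {c'..d}" "a < b" "c' < d"
  shows "rect (half Ver False c) = {a..(a + b) / 2} \<times> {c'..d}"
    "rect (half Ver True c) = {(a + b) / 2..b} \<times> {c'..d}"
    "rect (half Hor False c) = {a..b} \<times> {c'..(c' + d) / 2}"
    "rect (half Hor True c) = {a..b} \<times> {(c' + d) / 2..d}"
proof -
  obtain m u v where c: "c = (m, u, v)" by (metis prod.exhaust)
  note ends = box_eq[OF assms(1)[symmetric, unfolded c rect.simps] assms(2,3)]
  show "rect (half Ver False c) = {a..(a + b) / 2} \<times> {c'..d}"
    "rect (half Ver True c) = {(a + b) / 2..b} \<times> {c'..d}"
    "rect (half Hor False c) = {a..b} \<times> {c'..(c' + d) / 2}"
    "rect (half Hor True c) = {a..b} \<times> {(c' + d) / 2..d}"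
    unfolding c by (auto simp: val_append field_simps simp flip: ends)
qed

lemma rect_box: obtains a b c' d where "rect c = {a..b} \<times> {c'..d}" "a < b" "c' < d"
proof (cases c)
  case (fields m u v)
  show ?thesis by (rule that[OF fields[THEN arg_cong[of _ _ rect], unfolded rect.simps]]) simp_all
qed

definition halve :: "dir \<Rightarrow> address \<Rightarrow> (real \<times> real) set set \<Rightarrow> (real \<times> real) set set" where
  "halve x c P = P - {rect c} \<union> {rect (half x False c), rect (half x True c)}"

lemma simple_increment_halve:
  assumes "rect c \<in> P"
  shows "simple_increment P (halve x c P)"
proof -
  obtain a b c' d where box: "rect c = {a..b} \<times> {c'..d}" "a < b" "c' < d"
    by (rule rect_box)
  show ?thesis
    using simple_increment.vertical[of a b c' d P] simple_increment.horizontal[of a b c' d P]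
        assms box
    by (cases x) (simp_all add: halve_def rect_half[OF box])
qed

lemma simple_increment_rect:
  assumes "simple_increment (rect ` K) P"
  shows "\<exists>c\<in>K. \<exists>x. P = halve x c (rect ` K)"
  using assms
proof cases
  case (vertical a b c' d)
  then obtain c where c: "c \<in> K" "rect c = {a..b} \<times> {c'..d}" by (auto simp: image_iff)
  then have "P = halve Ver c (rect ` K)"
    using vertical by (simp add: halve_def rect_half[OF c(2)])
  then show ?thesis using c by blast
next
  case (horizontal a b c' d)
  then obtain c where c: "c \<in> K" "rect c = {a..b} \<times> {c'..d}" by (auto simp: image_iff)
  then have "P = halve Hor c (rect ` K)"
    using horizontal by (simp add: halve_def rect_half[OF c(2)])
  then show ?thesis using c by blast
qed

lemma inj_word_numbering: "inj (word_numbering w)"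
  using inj_numbering[of "cls w"] by (simp add: numbering_cls)

text \<open>
  That the halved address disappears from the range depends on the injectivity of numberings: no
  other number has the same address.
\<close>

lemma range_word_numbering_Div:
  "range (word_numbering (w @ [Div x i])) = range (word_numbering w) - {word_numbering w i}
    \<union> {half x False (word_numbering w i), half x True (word_numbering w i)}"
proof -
  define C where "C = word_numbering w"
  define E where "E = word_numbering (w @ [Div x i])"
  have E: "E n = (if n < i then C n else if n = i then half x False (C i)
      else if n = Suc i then half x True (C i) else C (n - 1))" for n
    by (simp add: E_def C_def word_numbering_append word_numbering_Cons star_def refine_half)
  have "UNIV = {..<i} \<union> {i, Suc i} \<union> Suc ` {Suc i..}"
  proof -
    have "n < i \<or> n = i \<or> n = Suc i \<or> n \<in> Suc ` {Suc i..}" for n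
      by (cases n) auto
    then show ?thesis by blast
  qed
  then have "range E = E ` {..<i} \<union> E ` {i, Suc i} \<union> E ` Suc ` {Suc i..}"
    by (metis image_Un)
  also have "E ` {..<i} = C ` {..<i}" by (rule image_cong[OF HOL.refl]) (simp add: E)
  also have "E ` Suc ` {Suc i..} = C ` {Suc i..}"
    unfolding image_image by (rule image_cong[OF HOL.refl]) (simp add: E)
  also have "E ` {i, Suc i} = {half x False (C i), half x True (C i)}"
    by (simp add: E insert_commute)
  finally have "range E = C ` ({..<i} \<union> {Suc i..}) \<union> {half x False (C i), half x True (C i)}"
    by (auto simp: image_Un)
  also have "{..<i} \<union> {Suc i..} = UNIV - {i}" by auto
  also have "C ` (UNIV - {i}) = range C - {C i}"
    unfolding C_def using inj_word_numbering by (simp add: image_set_diff)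
  finally show ?thesis by (simp add: C_def E_def)
qed

lemma range_word_numbering_Swap: "range (word_numbering (w @ map Swap s))
    = range (word_numbering w)"
  using bij_perm[of s]
  by (simp only: word_numbering_append word_numbering_Swap star_perm image_comp[symmetric]
      bij_is_surj)

lemma rect_range_word_numbering_Div:
  "rect ` range (word_numbering (w @ [Div x i]))
      = halve x (word_numbering w i) (rect ` range (word_numbering w))"
  using inj_rect by (simp add: range_word_numbering_Div halve_def image_Un image_set_diff)

lemma is_pattern_word_numbering: "is_pattern (rect ` range (word_numbering w))"
proof (induction w rule: rev_induct)
  case Nil
  have "rect ` range (word_numbering []) = range Sq" by (simp add: image_image)
  then show ?case by (simp add: is_pattern_def)
next
  case (snoc g w)
  show ?case
  proof (cases g)
    case (Div x i)
    have "simple_increment (rect ` range (word_numbering w)) (rect ` range (word_numbering (w @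
        [Div x i])))"
      unfolding rect_range_word_numbering_Div by (rule simple_increment_halve) simp
    then show ?thesis
      using snoc unfolding is_pattern_def Div by (rule rtranclp.rtrancl_into_rtrancl[rotated])
  next
    case (Swap j)
    then show ?thesis using range_word_numbering_Swap[of w "[j]"] snoc by simp
  qed
qed

lemma is_pattern_word:
  assumes "is_pattern P"
  shows "\<exists>w. P = rect ` range (word_numbering w)"
  using assms unfolding is_pattern_def
proof (induction rule: rtranclp_induct)
  case base
  have "rect ` range (word_numbering []) = range Sq" by (simp add: image_image)
  then show ?case by metis
next
  case (step P P')
  then obtain w where w: "P = rect ` range (word_numbering w)" by blast
  then obtain c x where "c \<in> range (word_numbering w)" "P'
      = halve x c (rect ` range (word_numbering w))"
    using step.hyps(2) simple_increment_rect by blast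
  then show ?case using rect_range_word_numbering_Div by (metis imageE)
qed

text \<open>
  Far out, each square is a single rectangle and the numbers are shifted by \<open>j\<close>. In this form
  the property is closed under composition, with the shifts adding up.
\<close>

definition tail_shift :: "nat \<Rightarrow> (nat \<Rightarrow> address) \<Rightarrow> bool" where
  "tail_shift j C \<longleftrightarrow>
    (\<exists>k. \<forall>i>k. C (i + j) = triv i \<and> (\<forall>n. fst (C n) = i \<longrightarrow> n = i + j))"

lemma tail_shift_star:
  assumes "tail_shift j C" "tail_shift j' E"
  shows "tail_shift (j + j') (C \<star> E)"
proof -
  obtain k k' where
    k: "\<And>i. i > k \<Longrightarrow> C (i + j) = triv i \<and> (\<forall>n. fst (C n) = i \<longrightarrow> n = i + j)" and
    k': "\<And>i. i > k' \<Longrightarrow> E (i + j') = triv i \<and> (\<forall>n. fst (E n) = i \<longrightarrow> n = i + j')"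
    using assms unfolding tail_shift_def by blast
  have "(C \<star> E) (i + (j + j')) = triv i \<and> (\<forall>n. fst ((C \<star> E) n) = i \<longrightarrow> n = i + (j + j'))"
    if "i > max k k'" for i
    using k[of i] k'[of "i + j"] that by (auto simp: star_def add.assoc)
  then show ?thesis unfolding tail_shift_def by blast
qed

lemma tail_shift_gen_numbering: "\<exists>j. tail_shift j (gen_numbering g)"
proof (cases g)
  case (Div x i)
  have "tail_shift 1 (gen_numbering g)"
    unfolding tail_shift_def Div by (rule exI[of _ i]) auto
  then show ?thesis by blast
next
  case (Swap i)
  have "tail_shift 0 (gen_numbering g)"
    unfolding tail_shift_def Swap
        by (rule exI[of _ "Suc i"]) (auto simp: transpose_def split: if_splits)
  then show ?thesis by blast
qed

lemma tail_shift_word_numbering: "\<exists>j. tail_shift j (word_numbering w)"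
proof (induction w)
  case Nil
  have "tail_shift 0 (word_numbering [])" by (simp add: tail_shift_def)
  then show ?case by blast
next
  case (Cons g w)
  then show ?case using tail_shift_gen_numbering[of g] tail_shift_star
      by (metis word_numbering_Cons)
qed

lemma tail_shift_pattern:
  assumes "tail_shift j C"
  shows "\<exists>k. \<forall>i>k. {Q \<in> rect ` range C. Q \<subseteq> Sq i} = {rect (C (i + j))}"
proof -
  obtain k where k: "\<And>i. i > k \<Longrightarrow> C (i + j) = triv i \<and> (\<forall>n. fst (C n) = i \<longrightarrow> n = i + j)"
    using assms unfolding tail_shift_def by blast
  have "{Q \<in> rect ` range C. Q \<subseteq> Sq i} = {rect (C (i + j))}" if "i > k" for i
  proof -
    have "rect (C n) \<subseteq> Sq i \<longleftrightarrow> n = i + j" for n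
      using k[OF that] by (metis fst_triv rect_subset_iff)
    then show ?thesis by auto
  qed
  then show ?thesis by blast
qed

lemma numbered_pattern_word_numbering: "numbered_pattern (rect \<circ> word_numbering w)"
proof -
  obtain j where "tail_shift j (word_numbering w)" using tail_shift_word_numbering by blast
  then have "\<exists>k. \<forall>i>k. {Q \<in> rect ` range (word_numbering w). Q \<subseteq> Sq i}
      = {(rect \<circ> word_numbering w) (i + j)}"
    using tail_shift_pattern by simp
  moreover have "bij_betw (rect \<circ> word_numbering w) UNIV (rect ` range (word_numbering w))"
    using inj_rect inj_word_numbering by (simp add: bij_betw_def inj_compose image_comp)
  ultimately show ?thesis
    unfolding numbered_pattern_def
    by - (rule exI, intro conjI, rule is_pattern_word_numbering, assumption, rule exI, assumption)
qed

text \<open>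
  The bijection maps an initial segment of length \<open>k + j\<close> onto one of length \<open>k + j'\<close>, so that
  \<open>j\<close> and \<open>j'\<close> are equal.
\<close>

lemma bij_eventual_shift:
  fixes p :: "nat \<Rightarrow> nat"
  assumes "bij p" and shift: "\<And>i. i \<ge> k \<Longrightarrow> p (i + j) = i + j'"
  shows "p permutes {..<k + j}"
proof -
  have "p ` {k + j..} = {k + j'..}"
  proof (intro equalityI subsetI)
    fix n assume "n \<in> {k + j'..}"
    then have "n = p ((n - j') + j)" "n - j' + j \<in> {k + j..}"
      using shift[of "n - j'"] by auto
    then show "n \<in> p ` {k + j..}" by blast
  next
    fix n assume "n \<in> p ` {k + j..}"
    then obtain m where m: "n = p m" "k + j \<le> m" by auto
    then show "n \<in> {k + j'..}" using shift[of "m - j"] by simp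
  qed
  moreover have "p ` (- {k + j..}) = - p ` {k + j..}"
    using \<open>bij p\<close> by (rule bij_image_Compl_eq)
  ultimately have "p ` {..<k + j} = {..<k + j'}" by (simp add: Compl_atLeast)
  then have "card {..<k + j} = card {..<k + j'}"
    using \<open>bij p\<close> by (metis bij_is_inj card_image inj_on_subset subset_UNIV)
  then have "j = j'" by simp
  have "p n = n" if "n \<ge> k + j" for n
    using shift[of "n - j"] that \<open>j = j'\<close> by simp
  then show ?thesis
    using \<open>bij p\<close> by (auto simp: permutes_def bij_iff)
qed

text \<open>
  The pattern comes from some word, which numbers it in its own way. The two numberings differ
  by a permutation \<open>p\<close>, and \<open>p\<close> has finite support since both are shifts far out.
\<close>

lemma numbered_pattern_word:
  assumes "numbered_pattern R"
  shows "\<exists>w. R = rect \<circ> word_numbering w"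
proof -
  obtain P j k where P: "is_pattern P" "bij_betw R UNIV P"
    and k: "\<And>i. i > k \<Longrightarrow> {Q \<in> P. Q \<subseteq> Sq i} = {R (i + j)}"
    using assms unfolding numbered_pattern_def by blast
  obtain w where w: "P = rect ` range (word_numbering w)" using is_pattern_word P(1) by blast
  have Rw: "bij_betw (rect \<circ> word_numbering w) UNIV P"
    unfolding w using inj_rect inj_word_numbering by (simp add: bij_betw_def inj_compose image_comp)
  define p where "p = inv_into UNIV (rect \<circ> word_numbering w) \<circ> R"
  have "bij p"
    unfolding p_def using P(2) bij_betw_inv_into[OF Rw] by (rule bij_betw_trans)
  have R: "R n = rect (word_numbering w (p n))" for n
    using bij_betw_inv_into_right[OF Rw, of "R n"] bij_betwE[OF P(2)] by (simp add: p_def)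
  obtain j' k' where k': "\<And>i. i > k' \<Longrightarrow> {Q \<in> P. Q \<subseteq> Sq i} = {rect (word_numbering w (i + j'))}"
    using tail_shift_word_numbering[of w] tail_shift_pattern unfolding w by meson
  have "p (i + j) = i + j'" if "i \<ge> Suc (max k k')" for i
  proof -
    have "R (i + j) = rect (word_numbering w (i + j'))" using k[of i] k'[of i] that by auto
    then show ?thesis using inj_word_numbering[of w] by (simp add: R rect_inject inj_eq)
  qed
  then obtain s where "p = perm s"
    using bij_eventual_shift[OF \<open>bij p\<close>] perm_onto by blast
  then have "R = rect \<circ> word_numbering (w @ map Swap s)"
    by (auto simp: fun_eq_iff R word_numbering_append word_numbering_Swap star_perm)
  then show ?thesis by blast
qed

lemma carrier_Pi: "carrier Pi_monoid = range (\<lambda>w. realize (word_numbering w))"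
proof -
  have "numbered_pattern R \<longleftrightarrow> R \<in> range (\<lambda>w. rect \<circ> word_numbering w)" for R
    using numbered_pattern_word_numbering numbered_pattern_word by blast
  then have "carrier Pi_monoid = pattern_fun ` range (\<lambda>w. rect \<circ> word_numbering w)"
    unfolding Pi_monoid_def by auto
  then show ?thesis by (simp only: image_image realize_def)
qed

section \<open>The presentation\<close>

lemma word_class_eq_iff: "word_class Rel u = word_class Rel w \<longleftrightarrow> word_cong Rel u w"
  unfolding word_class_def
  by (auto intro: word_cong.refl word_cong.sym word_cong.trans)

text \<open>
  Evaluation of words in \<open>M\<close> is onto and identifies exactly the congruent words. That \<open>M\<close> is a
  monoid follows since it is a homomorphic image of the monoid of words.
\<close>

lemma has_monoid_presentationI:
  fixes M :: "('a, 'b) monoid_scheme"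
  assumes one: "G [] = \<one>\<^bsub>M\<^esub>"
    and mult: "\<And>u w. G (u @ w) = G u \<otimes>\<^bsub>M\<^esub> G w"
    and carrier: "carrier M = range G"
    and cong: "\<And>u w. G u = G w \<longleftrightarrow> word_cong Rel u w"
    and gen: "\<And>g. \<phi> g = G [g]"
  shows "has_monoid_presentation M \<phi> Rel"
proof -
  define F where "F A = G (SOME w. A = word_class Rel w)" for A
  have F: "F (word_class Rel w) = G w" for w
  proof -
    have "word_class Rel w = word_class Rel (SOME u. word_class Rel w = word_class Rel u)"
      by (rule someI) (rule HOL.refl)
    then show ?thesis unfolding F_def by (metis cong word_class_eq_iff)
  qed
  have prod:
    "word_class Rel u \<otimes>\<^bsub>presented_monoid Rel\<^esub> word_class Rel w = word_class Rel (u @ w)"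
    for u w
  proof -
    have "word_class Rel (u' @ w') = word_class Rel (u @ w)"
      if "u' \<in> word_class Rel u" "w' \<in> word_class Rel w" for u' w'
      using that unfolding word_class_eq_iff
      by (auto simp: word_class_def intro: word_cong.append word_cong.sym)
    moreover have "u \<in> word_class Rel u" "w \<in> word_class Rel w"
      by (simp_all add: word_class_def word_cong.refl)
    ultimately have "(\<Union>u'\<in>word_class Rel u. \<Union>w'\<in>word_class Rel w. word_class Rel (u' @ w'))
        = word_class Rel (u @ w)"
      by (metis (no_types, lifting) SUP_eq_const empty_iff)
    then show ?thesis by (simp add: presented_monoid_def)
  qed
  have carrier': "carrier (presented_monoid Rel) = range (word_class Rel)"
    by (simp add: presented_monoid_def)
  have "monoid M"
  proof (rule monoidI)
    show "x \<otimes>\<^bsub>M\<^esub> y \<in> carrier M" if "x \<in> carrier M" "y \<in> carrier M" for x y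
      using that by (auto simp: carrier simp flip: mult)
    show "\<one>\<^bsub>M\<^esub> \<in> carrier M" by (simp add: carrier flip: one)
    show "x \<otimes>\<^bsub>M\<^esub> y \<otimes>\<^bsub>M\<^esub> z = x \<otimes>\<^bsub>M\<^esub> (y \<otimes>\<^bsub>M\<^esub> z)"
      if "x \<in> carrier M" "y \<in> carrier M" "z \<in> carrier M" for x y z
      using that by (auto simp: carrier simp flip: mult)
    show "\<one>\<^bsub>M\<^esub> \<otimes>\<^bsub>M\<^esub> x = x" if "x \<in> carrier M" for x
      using that by (auto simp: carrier simp flip: mult one)
    show "x \<otimes>\<^bsub>M\<^esub> \<one>\<^bsub>M\<^esub> = x" if "x \<in> carrier M" for x
      using that by (auto simp: carrier simp flip: mult one)
  qed
  moreover have "F \<in> iso (presented_monoid Rel) M"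
  proof -
    have "F \<in> hom (presented_monoid Rel) M"
      by (auto simp: hom_def carrier' prod F mult carrier)
    moreover have "bij_betw F (carrier (presented_monoid Rel)) (carrier M)"
      by (auto simp: bij_betw_def inj_on_def carrier'
          F cong word_class_eq_iff carrier image_image)
    ultimately show ?thesis by (simp add: iso_def)
  qed
  moreover have "range \<phi> \<subseteq> carrier M" by (auto simp: gen carrier)
  ultimately show ?thesis
    unfolding has_monoid_presentation_def by (auto simp: F gen intro: bexI[of _ F])
qed

theorem theorem1: "has_monoid_presentation Pi_monoid gen_val Pi_relations"
proof (rule has_monoid_presentationI[where G = "\<lambda>w. realize (word_numbering w)"])
  show "realize (word_numbering []) = \<one>\<^bsub>Pi_monoid\<^esub>"
    by (simp add: Pi_monoid_def realize_triv)
  show "realize (word_numbering (u @ w))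
      = realize (word_numbering u) \<otimes>\<^bsub>Pi_monoid\<^esub> realize (word_numbering w)" for u w
    by (simp add: Pi_monoid_def word_numbering_append realize_star)
  show "carrier Pi_monoid = range (\<lambda>w. realize (word_numbering w))"
    by (rule carrier_Pi)
  show "realize (word_numbering u) = realize (word_numbering w) \<longleftrightarrow> word_cong Pi_relations u w"
      for u w
    by (simp only: realize_inject numbering_inject cls_eq_iff flip: numbering_cls)
  show "gen_val g = realize (word_numbering [g])" for g
    by (simp add: gen_val_eq word_numbering_Cons)
qed

end
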